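(* The sets with low $e$-degree, i.e. the class $\{X\subseteq\omega : J_e(X)\equiv_e J_e(\emptyset)\}$, do not form a splitting class in the $e$-degrees.
   Context: An enumeration operator is a map $\Phi:2^\omega\to 2^\omega$ given by a c.e. set $W$ via $\Phi(A)=\{x:(\exists u)[\langle x,u\rangle\in W\ \&\ D_u\subseteq A]\}$, $D_u$ being the finite set with canonical index $u$; $\Phi_e$ is the operator given by the $e$-th c.e. set $W_e$. $A\le_e B$ iff $A=\Phi(B)$ for some enumeration operator $\Phi$; $A\equiv_e B$ iff $A\le_e B$ and $B\le_e A$; $A<_e B$ iff $A\le_e B$ and $B\nleq_e A$. $A\oplus B=\{2x:x\in A\}\cup\{2x+1:x\in B\}$; $X^c=\omega\smallsetminus X$. For a set $X$, $K_X=\{e:e\in\Phi_e(X)\}$ and the enumeration jump is $J_e(X)=K_X\oplus(K_X)^c$. A nonempty, countable, downwards $\le_e$-closed class $\mathcal{A}\subseteq 2^\omega$ is a splitting class (in the $e$-degrees) if for every $A\in\mathcal{A}$ and every finite $\mathcal{B}\subseteq\{B\in\mathcal{A}:B\nleq_e A\}$ there is $C\in\mathcal{A}$ with $C>_e A$ such that $B\oplus C\notin\mathcal{A}$ for all $B\in\mathcal{B}$. *)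

theory Defs
  imports Main "HOL-Library.Nat_Bijection" "HOL-Library.Countable_Set"
begin

datatype recf =
    Zero
  | Succ
  | Proj nat
  | Comp recf "recf list"
  | PrimRec recf recf
  | Mu recf

text \<open>
  \<open>computes f xs y\<close> means that the partial recursive function denoted by \<open>f\<close> converges on the
  argument list \<open>xs\<close> with value \<open>y\<close>. Arities are not recorded in the terms: a term applied to an
  argument list of unsuitable length diverges or ignores the surplus arguments, which does not
  affect the class of unary partial functions obtained. The recursion variable and the variable
  of minimisation come first in the argument list.
\<close>

inductive computes :: "recf \<Rightarrow> nat list \<Rightarrow> nat \<Rightarrow> bool" where
  Zero: "computes Zero xs 0"
| Succ: "computes Succ (x # xs) (Suc x)"
| Proj: "i < length xs \<Longrightarrow> computes (Proj i) xs (xs ! i)"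
| Comp: "list_all2 (\<lambda>g y. computes g xs y) gs ys \<Longrightarrow> computes f ys z \<Longrightarrow> computes (Comp f gs) xs z"
| PrimRec_0: "computes f xs y \<Longrightarrow> computes (PrimRec f g) (0 # xs) y"
| PrimRec_Suc: "computes (PrimRec f g) (n # xs) r \<Longrightarrow> computes g (n # r # xs) y
    \<Longrightarrow> computes (PrimRec f g) (Suc n # xs) y"
| Mu: "computes f (y # xs) 0 \<Longrightarrow> (\<forall>z<y. \<exists>v. computes f (z # xs) (Suc v)) \<Longrightarrow> computes (Mu f) xs y"

definition halting_set :: "recf \<Rightarrow> nat set" where
  "halting_set f = {x. \<exists>y. computes f [x] y}"

definition ce :: "nat set \<Rightarrow> bool" where
  "ce X \<longleftrightarrow> (\<exists>f. X = halting_set f)"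

primrec code :: "recf \<Rightarrow> nat" where
  "code Zero = prod_encode (0, 0)"
| "code Succ = prod_encode (1, 0)"
| "code (Proj i) = prod_encode (2, i)"
| "code (Comp f gs) = prod_encode (3, prod_encode (code f, list_encode (map code gs)))"
| "code (PrimRec f g) = prod_encode (4, prod_encode (code f, code g))"
| "code (Mu f) = prod_encode (5, code f)"

text \<open>
  The standard numbering of the c.e. sets induced by the Goedel numbering \<open>code\<close> of programs;
  a number that is not the code of a program is an index of the empty set.
\<close>

definition W :: "nat \<Rightarrow> nat set" where
  "W e = {x. \<exists>f. code f = e \<and> x \<in> halting_set f}"

lemma code_inject: "code f = code g \<Longrightarrow> f = g"
proof (induction f arbitrary: g)
  case Zero
  then show ?case by (cases g) auto
next
  case Succ
  then show ?case by (cases g) auto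
next
  case (Proj i)
  then show ?case by (cases g) auto
next
  case (Comp f gs)
  then obtain f' gs' where g: "g = Comp f' gs'" and
    eq: "code f = code f'" "map code gs = map code gs'"
    by (cases g) (auto simp: list_encode_eq)
  have "gs = gs'"
    using eq(2) Comp.IH(2)
    by (auto intro!: nth_equalityI dest: map_eq_imp_length_eq) (metis length_map nth_map nth_mem)
  then show ?case using g eq(1) Comp.IH(1) by simp
next
  case (PrimRec f1 f2)
  then show ?case by (cases g) auto
next
  case (Mu f)
  then show ?case by (cases g) auto
qed

lemma W_code: "W (code f) = halting_set f"
  by (auto simp: W_def dest: code_inject)

lemma range_W: "range W = {X. ce X}"
proof -
  have empty: "halting_set (Mu Succ) = {}"
    by (auto simp: halting_set_def elim!: computes.cases[of "Mu Succ"] computes.cases[of Succ])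
  have "ce (W e)" for e
  proof (cases "\<exists>f. code f = e")
    case True
    then show ?thesis by (auto simp: ce_def W_code)
  next
    case False
    then have "W e = halting_set (Mu Succ)" by (auto simp: W_def empty)
    then show ?thesis by (auto simp: ce_def)
  qed
  moreover have "X \<in> range W" if "ce X" for X
    using that by (metis W_code ce_def rangeI)
  ultimately show ?thesis by auto
qed

text \<open>
  \<^const>\<open>prod_encode\<close> is the Cantor pairing function, and \<open>set_decode u\<close> is the finite set
  with canonical index \<open>u\<close>, i.e. the set of positions of the digit 1 in the binary expansion of \<open>u\<close>.
\<close>

definition enum_op :: "nat set \<Rightarrow> nat set \<Rightarrow> nat set" where
  "enum_op V A = {x. \<exists>u. prod_encode (x, u) \<in> V \<and> set_decode u \<subseteq> A}"

definition enumeration_operator :: "(nat set \<Rightarrow> nat set) \<Rightarrow> bool" where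
  "enumeration_operator F \<longleftrightarrow> (\<exists>V. ce V \<and> F = enum_op V)"

definition Phi :: "nat \<Rightarrow> nat set \<Rightarrow> nat set" where
  "Phi e = enum_op (W e)"

definition enum_le :: "nat set \<Rightarrow> nat set \<Rightarrow> bool" (infix "\<le>\<^sub>e" 50) where
  "A \<le>\<^sub>e B \<longleftrightarrow> (\<exists>F. enumeration_operator F \<and> A = F B)"

definition enum_equiv :: "nat set \<Rightarrow> nat set \<Rightarrow> bool" (infix "\<equiv>\<^sub>e" 50) where
  "A \<equiv>\<^sub>e B \<longleftrightarrow> A \<le>\<^sub>e B \<and> B \<le>\<^sub>e A"

definition enum_less :: "nat set \<Rightarrow> nat set \<Rightarrow> bool" (infix "<\<^sub>e" 50) where
  "A <\<^sub>e B \<longleftrightarrow> A \<le>\<^sub>e B \<and> \<not> B \<le>\<^sub>e A"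

definition join :: "nat set \<Rightarrow> nat set \<Rightarrow> nat set" (infixl "\<oplus>" 65) where
  "A \<oplus> B = {2 * x | x. x \<in> A} \<union> {2 * x + 1 | x. x \<in> B}"

definition K :: "nat set \<Rightarrow> nat set" where
  "K X = {e. e \<in> Phi e X}"

definition enum_jump :: "nat set \<Rightarrow> nat set" where
  "enum_jump X = K X \<oplus> (- K X)"

definition splitting_class :: "nat set set \<Rightarrow> bool" where
  "splitting_class \<A> \<longleftrightarrow>
     \<A> \<noteq> {} \<and> countable \<A> \<and> (\<forall>B\<in>\<A>. \<forall>A. A \<le>\<^sub>e B \<longrightarrow> A \<in> \<A>) \<and>
     (\<forall>A\<in>\<A>. \<forall>\<B>. finite \<B> \<and> \<B> \<subseteq> {B \<in> \<A>. \<not> B \<le>\<^sub>e A} \<longrightarrow>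
        (\<exists>C\<in>\<A>. A <\<^sub>e C \<and> (\<forall>B\<in>\<B>. B \<oplus> C \<notin> \<A>)))"

end

theory Submission imports Defs
begin

text \<open>
  The failure is already visible over the least degree: the degree of the empty set together with
  two suitable low sets violates the splitting condition. The two sets form a Kalimullin pair, that
  is, sets \<open>A\<close> and \<open>B\<close> for which some c.e. relation \<open>M\<close> contains \<open>A \<times> B\<close> and is disjoint from
  \<open>-A \<times> -B\<close>.

  The key fact (\<open>kalimullin_pair_jump\<close>) concerns any set \<open>U\<close>: if
  \<open>\<not> B \<le>\<^sub>e U\<close>, then \<open>e \<notin> K (A \<oplus> U)\<close> holds iff some \<open>b \<in> B\<close> satisfies
  \<open>e \<notin> K ({a. M a b} \<oplus> U)\<close>. Indeed \<open>A \<subseteq> {a. M a b}\<close> for \<open>b \<in> B\<close>, and \<open>{a. M a b} \<subseteq> A\<close>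
  for \<open>b \<notin> B\<close>; so if the right-hand side failed for some \<open>e \<notin> K (A \<oplus> U)\<close>, then \<open>B\<close> would be
  exactly \<open>{b. e \<in> K ({a. M a b} \<oplus> U)}\<close>, which is enumerable from \<open>U\<close>. Hence the jump of
  \<open>A \<oplus> U\<close> is enumerable from \<open>A\<close>, \<open>B\<close> and the jump of \<open>U\<close>. When \<open>A\<close> and \<open>B\<close> lie below the jump of
  the empty set and \<open>U\<close> is low, \<open>A \<oplus> U\<close> is low as well.

  Consequently every low \<open>U\<close> has a low join with one of the two sets: either \<open>\<not> B \<le>\<^sub>e U\<close> and
  \<open>A \<oplus> U\<close> is low by the above, or \<open>B \<le>\<^sub>e U\<close>, so that \<open>B \<oplus> U \<le>\<^sub>e U\<close> is low by downward closure, which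
  is part of being a splitting class. With \<open>U = {}\<close> the key fact, applied to \<open>A, B\<close> and to \<open>B, A\<close>,
  shows that \<open>A\<close> and \<open>B\<close> themselves are low if neither is c.e. So no low \<open>C\<close> can have both
  \<open>A \<oplus> C\<close> and \<open>B \<oplus> C\<close> outside the low sets.

  For the pair one takes a lexicographic lower cut \<open>{u. D\<^sub>u \<le> X}\<close> and its complement, with
  \<open>M a b\<close> the comparison of \<open>D\<^sub>a\<close> and \<open>D\<^sub>b\<close> (\<open>kalimullin_pair_lower_cut\<close>). The set \<open>X\<close> is built bit
  by bit: the code of (bits so far, then a one) belongs to the cut iff the next bit is one, so a
  single bit defeats one requirement of the form ``the cut is not \<open>W\<^sub>m\<close>'' or ``its complement is not
  \<open>W\<^sub>m\<close>''. The bits are decided by questions about \<open>W\<^sub>m\<close>, so both sets are enumerable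
  from the jump of the empty set.

  Everything recursion-theoretic is phrased through the relation \<open>re_in J P\<close>: the predicate \<open>P\<close> can
  be enumerated from \<open>J\<close>. Its closure properties, a universal c.e. set and the parameter theorem turn
  every reducibility claim into reading off the syntactic shape of a formula.
\<close>

section \<open>Computable functions and decidable predicates\<close>

lemma computes_Proj_eq: "i < length xs \<Longrightarrow> xs ! i = y \<Longrightarrow> computes (Proj i) xs y"
  using computes.Proj by blast

lemma computes_Comp1:
  "computes g xs y \<Longrightarrow> computes f [y] z \<Longrightarrow> computes (Comp f [g]) xs z"
  by (rule computes.Comp[where ys = "[y]"]) auto

lemma computes_Comp2:
  "computes g xs y \<Longrightarrow> computes h xs y' \<Longrightarrow> computes f [y, y'] z \<Longrightarrow> computes (Comp f [g, h]) xs z"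
  by (rule computes.Comp[where ys = "[y, y']"]) auto

lemmas computes_intros =
  computes.Zero computes.Succ computes_Proj_eq computes_Comp1 computes_Comp2

inductive_cases computes_ZeroE: "computes Zero xs y"
inductive_cases computes_SuccE: "computes Succ xs y"
inductive_cases computes_ProjE: "computes (Proj i) xs y"
inductive_cases computes_CompE: "computes (Comp f gs) xs y"
inductive_cases computes_PrimRecE: "computes (PrimRec f g) xs y"
inductive_cases computes_MuE: "computes (Mu f) xs y"

lemma computes_deterministic: "computes f xs y \<Longrightarrow> computes f xs y' \<Longrightarrow> y = y'"
proof (induction arbitrary: y' rule: computes.induct)
  case (Comp xs gs ys f z)
  from Comp.prems obtain ys' where
    ys': "list_all2 (\<lambda>g y. computes g xs y) gs ys'" "computes f ys' y'"
    by (auto elim: computes_CompE)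
  have "ys = ys'"
    using Comp.IH(1) ys'(1)
  proof (induction arbitrary: ys' rule: list_all2_induct)
    case (Cons g gs y ys)
    then show ?case by (cases ys') auto
  qed simp
  then show ?case using Comp.IH(2) ys'(2) by simp
next
  case (PrimRec_0 f xs y g)
  from PrimRec_0.prems show ?case by (rule computes_PrimRecE) (use PrimRec_0.IH in auto)
next
  case (PrimRec_Suc f g n xs r y)
  from PrimRec_Suc.prems obtain r' where "computes (PrimRec f g) (n # xs) r'"
    "computes g (n # r' # xs) y'"
    by (rule computes_PrimRecE) auto
  then show ?case using PrimRec_Suc.IH by metis
next
  case (Mu f y xs)
  from Mu.prems have a: "computes f (y' # xs) 0" "\<forall>z<y'. \<exists>v. computes f (z # xs) (Suc v)"
    by (auto elim: computes_MuE)
  have "\<not> y < y'" using Mu.IH(1) a(2) by fastforce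
  moreover have "\<not> y' < y" using Mu.IH(2) a(1) by fastforce
  ultimately show ?case by simp
qed (auto elim: computes_ZeroE computes_SuccE computes_ProjE)

definition add_prog where "add_prog = PrimRec (Proj 0) (Comp Succ [Proj (Suc 0)])"
definition mult_prog where "mult_prog = PrimRec Zero (Comp add_prog [Proj (Suc 0), Proj 2])"
definition pred_prog where "pred_prog = PrimRec Zero (Proj 0)"
definition rsub_prog where "rsub_prog = PrimRec (Proj 0) (Comp pred_prog [Proj (Suc 0)])"
definition triangle_prog where
  "triangle_prog = PrimRec Zero (Comp add_prog [Comp Succ [Proj 0], Proj (Suc 0)])"
definition pair_prog where
  "pair_prog = Comp add_prog [Comp triangle_prog [Comp add_prog [Proj 0, Proj (Suc 0)]], Proj 0]"

lemma computes_add: "computes add_prog [m, n] (m + n)"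
  unfolding add_prog_def
  by (induction m) (auto intro!: computes_intros computes.PrimRec_0 intro: computes.PrimRec_Suc)

lemma computes_mult: "computes mult_prog [m, n] (m * n)"
  unfolding mult_prog_def
proof (induction m)
  case (Suc m)
  then show ?case
    using computes_add[of "m * n" n]
    by (auto intro!: computes.PrimRec_Suc[OF Suc] computes_intros simp: add.commute)
qed (auto intro!: computes_intros computes.PrimRec_0)

lemma computes_pred: "computes pred_prog [m] (m - 1)"
  unfolding pred_prog_def
  by (induction m) (auto intro!: computes_intros computes.PrimRec_0 intro: computes.PrimRec_Suc)

lemma computes_rsub: "computes rsub_prog [m, n] (n - m)"
  unfolding rsub_prog_def
proof (induction m)
  case (Suc m)
  show ?case
    using computes_pred[of "n - m"]
    by (auto intro!: computes.PrimRec_Suc[OF Suc] computes_intros)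
qed (auto intro!: computes_intros computes.PrimRec_0)

lemma computes_triangle: "computes triangle_prog [m] (triangle m)"
  unfolding triangle_prog_def
proof (induction m)
  case (Suc m)
  show ?case
    using computes_add[of "Suc m" "triangle m"]
    by (auto intro!: computes.PrimRec_Suc[OF Suc] computes_intros simp: add.commute)
qed (auto intro!: computes_intros computes.PrimRec_0)

lemma computes_pair: "computes pair_prog [m, n] (prod_encode (m, n))"
  unfolding pair_prog_def prod_encode_def prod.case
  by (rule computes_Comp2[OF computes_Comp1[OF computes_Comp2[OF computes_Proj_eq computes_Proj_eq
          computes_add] computes_triangle] computes_Proj_eq computes_add]) simp_all

abbreviation pair :: "nat \<Rightarrow> nat \<Rightarrow> nat" ("\<langle>_,_\<rangle>") where "\<langle>x,y\<rangle> \<equiv> prod_encode (x, y)"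
definition pfst :: "nat \<Rightarrow> nat" where "pfst z = fst (prod_decode z)"
definition psnd :: "nat \<Rightarrow> nat" where "psnd z = snd (prod_decode z)"

lemma pair_simps [simp]: "pfst \<langle>x,y\<rangle> = x" "psnd \<langle>x,y\<rangle> = y" "\<langle>pfst z,psnd z\<rangle> = z"
  by (simp_all add: pfst_def psnd_def)

text \<open>
  Only unary functions are treated: a context of several variables is one number built by pairing, so that closure rules have
  the same shape under any number of binders.
\<close>

definition computable :: "(nat \<Rightarrow> nat) \<Rightarrow> bool" where
  "computable F \<longleftrightarrow> (\<exists>f. \<forall>x. computes f [x] (F x))"

lemma computableI: "(\<And>x. computes f [x] (F x)) \<Longrightarrow> computable F"
  by (auto simp: computable_def)

lemma computable_id: "computable (\<lambda>x. x)"
  by (rule computableI[of "Proj 0"]) (auto intro!: computes_intros)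

lemma computable_comp:
  assumes "computable H" "computable F"
  shows "computable (\<lambda>x. H (F x))"
proof -
  obtain f h where "\<forall>x. computes f [x] (F x)" "\<forall>x. computes h [x] (H x)"
    using assms by (auto simp: computable_def)
  then show ?thesis by (intro computableI[of "Comp h [f]"]) (auto intro: computes_Comp1)
qed

lemma computable_comp2:
  assumes "\<And>x y. computes h [x, y] (H x y)" "computable F" "computable G"
  shows "computable (\<lambda>x. H (F x) (G x))"
proof -
  obtain f g where "\<forall>x. computes f [x] (F x)" "\<forall>x. computes g [x] (G x)"
    using assms by (auto simp: computable_def)
  then show ?thesis using assms(1)
    by (intro computableI[of "Comp h [f, g]"]) (auto intro: computes_Comp2)
qed

primrec const_prog :: "nat \<Rightarrow> recf" where
  "const_prog 0 = Zero"
| "const_prog (Suc n) = Comp Succ [const_prog n]"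

lemma computes_const: "computes (const_prog n) xs n"
proof (induction n)
  case (Suc n)
  show ?case unfolding const_prog.simps by (rule computes_Comp1[OF Suc computes.Succ])
qed (simp add: computes.Zero)

lemma computable_const: "computable (\<lambda>x. n)"
  by (rule computableI[OF computes_const])

lemma computable_Suc: "computable F \<Longrightarrow> computable (\<lambda>x. Suc (F x))"
  by (rule computable_comp[OF computableI[OF computes.Succ]])

lemmas computable_add = computable_comp2[OF computes_add]
lemmas computable_mult = computable_comp2[OF computes_mult]
lemmas computable_pair = computable_comp2[OF computes_pair]

lemma computable_diff: "computable F \<Longrightarrow> computable G \<Longrightarrow> computable (\<lambda>x. F x - G x)"
  by (rule computable_comp2[OF computes_rsub])

lemma computable_triangle: "computable F \<Longrightarrow> computable (\<lambda>x. triangle (F x))"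
  by (rule computable_comp[OF computableI[OF computes_triangle]])

lemma computes_Mu_Least:
  assumes "\<And>z. computes f (z # xs) (F z)" "F y = 0"
  shows "computes (Mu f) xs (LEAST z. F z = 0)"
proof (rule computes.Mu)
  show "computes f ((LEAST z. F z = 0) # xs) 0"
    using assms(1)[of "LEAST z. F z = 0"] LeastI[of "\<lambda>z. F z = 0", OF assms(2)] by simp
  show "\<forall>z<LEAST z. F z = 0. \<exists>v. computes f (z # xs) (Suc v)"
  proof (intro allI impI)
    fix z assume "z < (LEAST z. F z = 0)"
    then have "F z \<noteq> 0" by (rule not_less_Least)
    then show "\<exists>v. computes f (z # xs) (Suc v)" using assms(1)[of z] by (metis not0_implies_Suc)
  qed
qed

text \<open>
  Unpairing is a search for the diagonal of the Cantor enumeration that contains the given number; only minimisation and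
  truncated subtraction are needed.
\<close>

lemma triangle_root:
  "(LEAST t. Suc \<langle>a,b\<rangle> - triangle (Suc t) = 0) = a + b"
proof (rule Least_equality)
  show "Suc \<langle>a,b\<rangle> - triangle (Suc (a + b)) = 0" by (simp add: prod_encode_def)
  fix t assume *: "Suc \<langle>a,b\<rangle> - triangle (Suc t) = 0"
  have mono: "m \<le> n \<Longrightarrow> triangle m \<le> triangle n" for m n
    by (induction rule: dec_induct) auto
  show "a + b \<le> t"
  proof (rule ccontr)
    assume "\<not> a + b \<le> t"
    then have "triangle (Suc t) \<le> triangle (a + b)" by (intro mono) simp
    then show False using * by (simp add: prod_encode_def)
  qed
qed

lemma computable_pfst_psnd: "computable pfst" "computable psnd"
proof -
  define F where "F = (\<lambda>z. LEAST t. Suc z - triangle (Suc t) = 0)"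
  let ?f = "Comp rsub_prog [Comp triangle_prog [Comp Succ [Proj 0]], Comp Succ [Proj (Suc 0)]]"
  have "computes (Mu ?f) [z] (F z)" for z
    unfolding F_def
  proof (rule computes_Mu_Least[where y = "pfst z + psnd z"])
    show "computes ?f [t, z] (Suc z - triangle (Suc t))" for t
      by (rule computes_Comp2[OF computes_Comp1[OF computes_Comp1[OF computes_Proj_eq computes.Succ]
              computes_triangle] computes_Comp1[OF computes_Proj_eq computes.Succ] computes_rsub])
        simp_all
    show "Suc z - triangle (Suc (pfst z + psnd z)) = 0"
      using pair_simps(3)[of z] by (simp add: prod_encode_def)
  qed
  then have F: "computable F" by (rule computableI)
  have sum: "F z = pfst z + psnd z" for z
    unfolding F_def by (subst (1) pair_simps(3)[of z, symmetric]) (rule triangle_root)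
  have z: "z = triangle (F z) + pfst z" for z
    unfolding sum using pair_simps(3)[of z] by (simp add: prod_encode_def)
  have "pfst z = z - triangle (F z)" for z
    using z[of z] by linarith
  then have "pfst = (\<lambda>z. z - triangle (F z))" by blast
  moreover have "computable (\<lambda>z. z - triangle (F z))"
    by (intro computable_diff computable_id computable_triangle F)
  ultimately show fst: "computable pfst" by simp
  have "psnd = (\<lambda>z. F z - pfst z)" by (auto simp: sum)
  moreover have "computable (\<lambda>z. F z - pfst z)" by (rule computable_diff[OF F fst])
  ultimately show "computable psnd" by simp
qed

lemmas computable_pfst = computable_comp[OF computable_pfst_psnd(1)]
lemmas computable_psnd = computable_comp[OF computable_pfst_psnd(2)]

lemmas computable_intros = computable_id computable_const computable_Suc computable_add
  computable_mult computable_diff computable_pair computable_pfst computable_psnd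

text \<open>
  The parameter \<open>x\<close>, the counter and the accumulator are packed into one argument of the step program, so that
  the closure rule speaks of unary functions only.
\<close>

lemma computable_rec_nat:
  assumes "computable F"
    and "computable (\<lambda>z. G (pfst z) (pfst (psnd z)) (psnd (psnd z)))"
    and "computable H"
  shows "computable (\<lambda>x. rec_nat (F x) (G x) (H x))"
proof -
  obtain f g h where f: "\<And>x. computes f [x] (F x)" and h: "\<And>x. computes h [x] (H x)"
    and g: "\<And>z. computes g [z] (G (pfst z) (pfst (psnd z)) (psnd (psnd z)))"
    using assms by (auto simp: computable_def)
  let ?g = "Comp g [Comp pair_prog [Proj 2, Comp pair_prog [Proj 0, Proj (Suc 0)]]]"
  have step: "computes ?g [n, r, x] (G x n r)" for n r x
    using g[of "\<langle>x,\<langle>n,r\<rangle>\<rangle>"] by (auto intro!: computes_intros computes_pair)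
  have "computes (PrimRec f ?g) [n, x] (rec_nat (F x) (G x) n)" for n x
    by (induction n) (use f step in \<open>auto intro: computes.intros simp del: One_nat_def\<close>)
  then show ?thesis
    by (intro computableI[of "Comp (PrimRec f ?g) [h, Proj 0]"])
      (auto intro: computes_Comp2 h computes_Proj_eq)
qed

definition decidable :: "(nat \<Rightarrow> bool) \<Rightarrow> bool" where
  "decidable P \<longleftrightarrow> computable (\<lambda>x. of_bool (P x))"

lemma decidableI: "computable F \<Longrightarrow> (\<And>x. P x \<longleftrightarrow> F x = 0) \<Longrightarrow> decidable P"
proof -
  assume a: "computable F" "\<And>x. P x \<longleftrightarrow> F x = 0"
  have "(\<lambda>x. of_bool (P x)) = (\<lambda>x. 1 - F x)" by (auto simp: a(2))
  moreover have "computable (\<lambda>x. 1 - F x)" by (intro computable_intros a(1))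
  ultimately show "decidable P" by (simp add: decidable_def)
qed

lemma decidable_eq: "computable F \<Longrightarrow> computable G \<Longrightarrow> decidable (\<lambda>x. F x = G x)"
  by (rule decidableI[OF computable_add[OF computable_diff computable_diff, of F G G F]]) auto

lemma decidable_less: "computable F \<Longrightarrow> computable G \<Longrightarrow> decidable (\<lambda>x. F x < G x)"
  by (rule decidableI[OF computable_diff[OF computable_Suc, of F G]]) auto

lemma decidable_not: "decidable P \<Longrightarrow> decidable (\<lambda>x. \<not> P x)"
  by (rule decidableI[of "\<lambda>x. of_bool (P x)"]) (auto simp: decidable_def)

lemma decidable_conj: "decidable P \<Longrightarrow> decidable Q \<Longrightarrow> decidable (\<lambda>x. P x \<and> Q x)"
  unfolding decidable_def of_bool_conj by (rule computable_mult)

lemma decidable_disj: "decidable P \<Longrightarrow> decidable Q \<Longrightarrow> decidable (\<lambda>x. P x \<or> Q x)"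
  using decidable_not[OF decidable_conj[OF decidable_not decidable_not, of P Q]] by simp

lemma decidable_imp: "decidable P \<Longrightarrow> decidable Q \<Longrightarrow> decidable (\<lambda>x. P x \<longrightarrow> Q x)"
  unfolding imp_conv_disj by (intro decidable_disj decidable_not)

lemma decidable_iff: "decidable P \<Longrightarrow> decidable Q \<Longrightarrow> decidable (\<lambda>x. P x = Q x)"
  unfolding iff_conv_conj_imp by (intro decidable_conj decidable_imp)

lemma decidable_comp: "decidable P \<Longrightarrow> computable F \<Longrightarrow> decidable (\<lambda>x. P (F x))"
  unfolding decidable_def by (rule computable_comp)

lemma decidable_all:
  assumes "decidable (\<lambda>z. P (pfst z) (psnd z))" "computable H"
  shows "decidable (\<lambda>x. \<forall>y<H x. P x y)"
proof -
  have "of_bool (\<forall>y<n. P x y) = rec_nat 1 (\<lambda>k r. r * of_bool (P x k) :: nat) n" for x and n :: nat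
  proof (induction n)
    case (Suc n)
    have "(\<forall>y<Suc n. P x y) \<longleftrightarrow> (\<forall>y<n. P x y) \<and> P x n" by (auto simp: less_Suc_eq)
    then show ?case by (simp only: of_bool_conj Suc old.nat.simps)
  qed simp
  moreover have "computable (\<lambda>x. rec_nat 1 (\<lambda>k r. r * of_bool (P x k)) (H x))"
    using decidable_comp[OF assms(1), of "\<lambda>z. \<langle>pfst z,pfst (psnd z)\<rangle>"] assms(2)
    by (intro computable_rec_nat computable_intros)
      (simp_all only: decidable_def pair_simps computable_intros)
  ultimately show ?thesis by (simp add: decidable_def)
qed

lemma decidable_ex:
  assumes "decidable (\<lambda>z. P (pfst z) (psnd z))" "computable H"
  shows "decidable (\<lambda>x. \<exists>y<H x. P x y)"
  using decidable_not[OF decidable_all[of "\<lambda>x y. \<not> P x y", OF decidable_not assms(2)]] assms(1)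
  by simp

lemma computable_power2:
  assumes "computable F" shows "computable (\<lambda>x. 2 ^ F x)"
proof -
  have "(2::nat) ^ n = rec_nat 1 (\<lambda>k r. r + r) n" for n by (induction n) auto
  moreover have "computable (\<lambda>x. rec_nat 1 (\<lambda>k r. r + r) (F x))"
    by (intro computable_rec_nat computable_intros assms)
  ultimately show ?thesis by simp
qed

text \<open>
  A description of the binary digit \<open>i\<close> by bounded quantifiers; it makes membership in canonical finite sets
  decidable.
\<close>

lemma mem_set_decode:
  "i \<in> set_decode n \<longleftrightarrow> (\<exists>q<Suc n. \<exists>r<2 ^ i. n = (2 * q + 1) * 2 ^ i + r)"
proof
  assume "i \<in> set_decode n"
  then have "odd (n div 2 ^ i)" by (simp add: set_decode_def)
  then obtain q where q: "n div 2 ^ i = 2 * q + 1" by (auto elim: oddE)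
  then have "n = (2 * q + 1) * 2 ^ i + n mod 2 ^ i" by (metis div_mult_mod_eq)
  moreover have "q < Suc n" using q div_le_dividend[of n "2 ^ i"] by linarith
  ultimately show "\<exists>q<Suc n. \<exists>r<2 ^ i. n = (2 * q + 1) * 2 ^ i + r"
    by (metis mod_less_divisor zero_less_numeral zero_less_power)
next
  assume "\<exists>q<Suc n. \<exists>r<2 ^ i. n = (2 * q + 1) * 2 ^ i + r"
  then obtain q r where "r < 2 ^ i" "n = (2 * q + 1) * 2 ^ i + r" by blast
  then have "n div 2 ^ i = 2 * q + 1"
    by (simp only: div_mult_self3[of "2 ^ i" "2 * q + 1" r] div_less)
  then show "i \<in> set_decode n" by (simp add: set_decode_def)
qed

lemma decidable_set_decode:
  assumes F: "computable F" and G: "computable G"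
  shows "decidable (\<lambda>x. F x \<in> set_decode (G x))"
  unfolding mem_set_decode
  by (intro decidable_ex decidable_eq computable_intros computable_power2
      computable_comp[OF F] computable_comp[OF G])

lemma less_set_decode: "i \<in> set_decode n \<Longrightarrow> i < n"
proof -
  assume "i \<in> set_decode n"
  then have "2 ^ i \<le> n" by (auto simp: mem_set_decode)
  moreover have "i < 2 ^ i" by (rule less_exp)
  ultimately show ?thesis by linarith
qed

lemmas decidable_intros = decidable_eq decidable_less decidable_not decidable_conj decidable_disj
  decidable_imp decidable_iff decidable_all decidable_ex decidable_set_decode

section \<open>Predicates enumerable from an oracle\<close>

text \<open>
  The normal form of an enumeration reduction: \<open>u\<close> is the finite part of the oracle that is used,
  \<open>w\<close> an unbounded witness. Keeping \<open>u\<close> and \<open>w\<close> apart lets one decidable matrix serve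
  both for c.e. predicates (\<open>J = {}\<close>) and for reductions to \<open>J\<close>.
\<close>

definition re_in :: "nat set \<Rightarrow> (nat \<Rightarrow> bool) \<Rightarrow> bool" where
  "re_in J P \<longleftrightarrow> (\<exists>R. decidable R \<and> (\<forall>x. P x \<longleftrightarrow> (\<exists>u w. set_decode u \<subseteq> J \<and> R \<langle>x,\<langle>u,w\<rangle>\<rangle>)))"

lemma re_inI:
  "decidable R \<Longrightarrow> (\<And>x. P x \<longleftrightarrow> (\<exists>u w. set_decode u \<subseteq> J \<and> R \<langle>x,\<langle>u,w\<rangle>\<rangle>)) \<Longrightarrow> re_in J P"
  by (auto simp: re_in_def)

lemma re_inE:
  assumes "re_in J P"
  obtains R where "decidable R" "\<And>x. P x \<longleftrightarrow> (\<exists>u w. set_decode u \<subseteq> J \<and> R \<langle>x,\<langle>u,w\<rangle>\<rangle>)"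
  using assms by (auto simp: re_in_def)

lemma re_in_decidable: "decidable P \<Longrightarrow> re_in J P"
  by (rule re_inI[OF decidable_comp[OF _ computable_pfst[OF computable_id]]])
    (auto intro: exI[of "\<lambda>u. set_decode u \<subseteq> J" 0])

lemma re_in_mono:
  assumes "re_in {} P" shows "re_in J P"
proof -
  obtain R where R: "decidable R" "\<And>x. P x \<longleftrightarrow> (\<exists>u w. set_decode u \<subseteq> {} \<and> R \<langle>x,\<langle>u,w\<rangle>\<rangle>)"
    using re_inE[OF assms] by metis
  have empty: "set_decode u \<subseteq> {} \<longleftrightarrow> u = 0" for u
    using set_decode_inverse[of u] by (auto simp del: set_decode_inverse)
  have "decidable (\<lambda>z. R z \<and> pfst (psnd z) = 0)"
    by (intro decidable_intros computable_intros R(1))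
  then show ?thesis
  proof (rule re_inI)
    fix x
    have "P x \<longleftrightarrow> (\<exists>w. R \<langle>x,\<langle>0,w\<rangle>\<rangle>)" unfolding R(2) empty by simp
    moreover have "set_decode 0 \<subseteq> J" by simp
    ultimately show "P x \<longleftrightarrow>
      (\<exists>u w. set_decode u \<subseteq> J \<and> R \<langle>x,\<langle>u,w\<rangle>\<rangle> \<and> pfst (psnd \<langle>x,\<langle>u,w\<rangle>\<rangle>) = 0)"
      unfolding pair_simps by metis
  qed
qed

lemma re_in_comp:
  assumes "re_in J P" "computable F" shows "re_in J (\<lambda>x. P (F x))"
proof -
  obtain R where R: "decidable R" "\<And>x. P x \<longleftrightarrow> (\<exists>u w. set_decode u \<subseteq> J \<and> R \<langle>x,\<langle>u,w\<rangle>\<rangle>)"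
    using re_inE[OF assms(1)] by metis
  have "decidable (\<lambda>z. R \<langle>F (pfst z),psnd z\<rangle>)"
    by (intro decidable_comp[OF R(1)] computable_intros computable_comp[OF assms(2)])
  then show ?thesis by (rule re_inI) (simp add: R(2))
qed

lemma re_in_comp2:
  assumes "re_in J (\<lambda>z. P (pfst z) (psnd z))" "computable F" "computable G"
  shows "re_in J (\<lambda>x. P (F x) (G x))"
  using re_in_comp[OF assms(1) computable_pair[OF assms(2,3)]] by simp

lemma re_in_member: "computable F \<Longrightarrow> re_in J (\<lambda>x. F x \<in> J)"
proof (rule re_inI[of "\<lambda>z. F (pfst z) \<in> set_decode (pfst (psnd z))"])
  assume F: "computable F"
  show "decidable (\<lambda>z. F (pfst z) \<in> set_decode (pfst (psnd z)))"
    by (intro decidable_intros computable_intros computable_comp[OF F])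
  show "F x \<in> J \<longleftrightarrow> (\<exists>u w. set_decode u \<subseteq> J \<and> F (pfst \<langle>x,\<langle>u,w\<rangle>\<rangle>) \<in> set_decode (pfst (psnd \<langle>x,\<langle>u,w\<rangle>\<rangle>)))"
    for x
  proof -
    have "set_decode (set_encode {F x}) = {F x}" by (intro set_encode_inverse) simp
    then show ?thesis unfolding pair_simps by (metis empty_subsetI insert_subset singletonI subsetD)
  qed
qed

lemma re_in_ex:
  assumes "re_in J (\<lambda>z. P (pfst z) (psnd z))" shows "re_in J (\<lambda>x. \<exists>y. P x y)"
proof -
  obtain R where R: "decidable R" "\<And>x y. P x y \<longleftrightarrow> (\<exists>u w. set_decode u \<subseteq> J \<and> R \<langle>\<langle>x,y\<rangle>,\<langle>u,w\<rangle>\<rangle>)"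
    using assms by (elim re_inE) (metis pair_simps(1,2))
  let ?R = "\<lambda>z. R \<langle>\<langle>pfst z,pfst (psnd (psnd z))\<rangle>,\<langle>pfst (psnd z),psnd (psnd (psnd z))\<rangle>\<rangle>"
  have "decidable ?R"
    by (intro decidable_comp[OF R(1)] computable_intros)
  then show ?thesis
  proof (rule re_inI)
    fix x
    have "(\<exists>y. P x y) \<longleftrightarrow> (\<exists>u y w. set_decode u \<subseteq> J \<and> ?R \<langle>x,\<langle>u,\<langle>y,w\<rangle>\<rangle>\<rangle>)"
      by (auto simp: R(2))
    also have "\<dots> \<longleftrightarrow> (\<exists>u w. set_decode u \<subseteq> J \<and> ?R \<langle>x,\<langle>u,w\<rangle>\<rangle>)"
      by (metis pair_simps(3))
    finally show "(\<exists>y. P x y) \<longleftrightarrow> (\<exists>u w. set_decode u \<subseteq> J \<and> ?R \<langle>x,\<langle>u,w\<rangle>\<rangle>)" .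
  qed
qed

text \<open>
  Bounded quantification is the source of conjunction and of transitivity of \<open>\<le>\<^sub>e\<close>. Finitely many uses
  of the oracle have a common bound \<open>u\<close>, the code of their union, because a subset has a smaller canonical
  index; so no coding of sequences is needed.
\<close>

lemma re_in_all:
  assumes "re_in J (\<lambda>z. P (pfst z) (psnd z))" "computable H"
  shows "re_in J (\<lambda>x. \<forall>y<H x. P x y)"
proof -
  obtain R where R: "decidable R" "\<And>x y. P x y \<longleftrightarrow> (\<exists>u w. set_decode u \<subseteq> J \<and> R \<langle>\<langle>x,y\<rangle>,\<langle>u,w\<rangle>\<rangle>)"
    using assms(1) by (elim re_inE) (metis pair_simps(1,2))
  let ?Q = "\<lambda>x u w. \<forall>y<H x. \<exists>u'<Suc u. \<exists>w'<w.
    (\<forall>i<u'. i \<in> set_decode u' \<longrightarrow> i \<in> set_decode u) \<and> R \<langle>\<langle>x,y\<rangle>,\<langle>u',w'\<rangle>\<rangle>"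
  have "decidable (\<lambda>z. ?Q (pfst z) (pfst (psnd z)) (psnd (psnd z)))"
    by (intro decidable_intros decidable_comp[OF R(1)] computable_intros computable_comp[OF assms(2)])
  then show ?thesis
  proof (rule re_inI)
    fix x
    have "(\<forall>y<H x. P x y) \<longleftrightarrow> (\<exists>u w. set_decode u \<subseteq> J \<and> ?Q x u w)"
    proof
      assume "\<forall>y<H x. P x y"
      then obtain U V where UV: "\<And>y. y < H x \<Longrightarrow> set_decode (U y) \<subseteq> J \<and> R \<langle>\<langle>x,y\<rangle>,\<langle>U y,V y\<rangle>\<rangle>"
        unfolding R(2) by metis
      define D where "D = (\<Union>y<H x. set_decode (U y))"
      define u where "u = set_encode D"
      define w where "w = Suc (\<Sum>y<H x. V y)"
      have D: "finite D" by (auto simp: D_def)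
      have u: "set_decode u = D" using D by (simp add: u_def)
      have "set_decode u \<subseteq> J" using UV by (auto simp: u D_def)
      moreover have "?Q x u w"
      proof (intro allI impI)
        fix y assume y: "y < H x"
        have sub: "set_decode (U y) \<subseteq> D" using y by (auto simp: D_def)
        have "U y = set_encode (set_decode (U y))" by simp
        also have "\<dots> \<le> u" unfolding u_def set_encode_def
          using sub D by (intro sum_mono2) auto
        finally have "U y < Suc u" by simp
        moreover have "V y < w" using member_le_sum[of y "{..<H x}" V] y by (simp add: w_def)
        ultimately show "\<exists>u'<Suc u. \<exists>w'<w.
            (\<forall>i<u'. i \<in> set_decode u' \<longrightarrow> i \<in> set_decode u) \<and> R \<langle>\<langle>x,y\<rangle>,\<langle>u',w'\<rangle>\<rangle>"
          using sub UV[OF y] u by blast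
      qed
      ultimately show "\<exists>u w. set_decode u \<subseteq> J \<and> ?Q x u w" by blast
    next
      assume "\<exists>u w. set_decode u \<subseteq> J \<and> ?Q x u w"
      then obtain u w where u: "set_decode u \<subseteq> J" "?Q x u w" by blast
      show "\<forall>y<H x. P x y"
      proof (intro allI impI)
        fix y assume "y < H x"
        then obtain u' w' where u': "\<forall>i<u'. i \<in> set_decode u' \<longrightarrow> i \<in> set_decode u" "R \<langle>\<langle>x,y\<rangle>,\<langle>u',w'\<rangle>\<rangle>"
          using u(2) by blast
        then have "set_decode u' \<subseteq> J" using u(1) less_set_decode by blast
        then show "P x y" using u'(2) R(2) by blast
      qed
    qed
    then show "(\<forall>y<H x. P x y) \<longleftrightarrow> (\<exists>u w. set_decode u \<subseteq> J \<and>
        ?Q (pfst \<langle>x,\<langle>u,w\<rangle>\<rangle>) (pfst (psnd \<langle>x,\<langle>u,w\<rangle>\<rangle>)) (psnd (psnd \<langle>x,\<langle>u,w\<rangle>\<rangle>)))"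
      by simp
  qed
qed

lemma re_in_disj:
  assumes "re_in J P" "re_in J Q" shows "re_in J (\<lambda>x. P x \<or> Q x)"
proof -
  obtain R where R: "decidable R" "\<And>x. P x \<longleftrightarrow> (\<exists>u w. set_decode u \<subseteq> J \<and> R \<langle>x,\<langle>u,w\<rangle>\<rangle>)"
    using re_inE[OF assms(1)] by metis
  obtain S where S: "decidable S" "\<And>x. Q x \<longleftrightarrow> (\<exists>u w. set_decode u \<subseteq> J \<and> S \<langle>x,\<langle>u,w\<rangle>\<rangle>)"
    using re_inE[OF assms(2)] by metis
  show ?thesis
    by (rule re_inI[of "\<lambda>z. R z \<or> S z"]) (auto intro: decidable_disj R(1) S(1) simp: R(2) S(2))
qed

lemma re_in_conj:
  assumes "re_in J P" "re_in J Q" shows "re_in J (\<lambda>x. P x \<and> Q x)"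
proof -
  obtain R where R: "decidable R" "\<And>x. P x \<longleftrightarrow> (\<exists>u w. set_decode u \<subseteq> J \<and> R \<langle>x,\<langle>u,w\<rangle>\<rangle>)"
    using re_inE[OF assms(1)] by metis
  obtain S where S: "decidable S" "\<And>x. Q x \<longleftrightarrow> (\<exists>u w. set_decode u \<subseteq> J \<and> S \<langle>x,\<langle>u,w\<rangle>\<rangle>)"
    using re_inE[OF assms(2)] by metis
  have "re_in J (\<lambda>z. if psnd z = 0 then P (pfst z) else Q (pfst z))"
    by (rule re_inI[of "\<lambda>z. (psnd (pfst z) = 0 \<longrightarrow> R \<langle>pfst (pfst z),psnd z\<rangle>) \<and>
          (\<not> psnd (pfst z) = 0 \<longrightarrow> S \<langle>pfst (pfst z),psnd z\<rangle>)"])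
      (auto intro!: decidable_intros decidable_comp[OF R(1)] decidable_comp[OF S(1)] computable_intros
        simp: R(2) S(2))
  then have "re_in J (\<lambda>x. \<forall>y<2::nat. if y = 0 then P x else Q x)"
    by (intro re_in_all computable_intros)
  moreover have "(\<forall>y<2::nat. if y = 0 then P x else Q x) \<longleftrightarrow> P x \<and> Q x" for x
    by (auto simp: less_2_cases_iff)
  ultimately show ?thesis by simp
qed

lemmas re_in_eq = re_in_decidable[OF decidable_eq]
lemmas re_in_less = re_in_decidable[OF decidable_less]
lemmas re_in_not = re_in_decidable[OF decidable_not]
lemmas re_in_set_decode = re_in_decidable[OF decidable_set_decode]

lemma re_in_imp: "decidable P \<Longrightarrow> re_in J Q \<Longrightarrow> re_in J (\<lambda>x. P x \<longrightarrow> Q x)"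
  unfolding imp_conv_disj by (intro re_in_disj re_in_not)

lemmas re_in_intros = re_in_ex re_in_all re_in_disj re_in_conj re_in_imp re_in_eq re_in_less
  re_in_not re_in_set_decode

section \<open>Least fixed points of two-premise rule systems\<close>

text \<open>
  A universal c.e. set arises from the observation that every least set closed under a c.e. set of axioms and two-premise
  rules is c.e. The evaluation of programs is such a system, once evaluation of argument lists and unsuccessful searches are
  made into judgements of their own.
\<close>

inductive derivable :: "(nat \<Rightarrow> bool) \<Rightarrow> (nat \<Rightarrow> nat \<Rightarrow> nat \<Rightarrow> bool) \<Rightarrow> nat \<Rightarrow> bool" for A R where
  axiom: "A j \<Longrightarrow> derivable A R j"
| step: "derivable A R i \<Longrightarrow> derivable A R i' \<Longrightarrow> R i i' j \<Longrightarrow> derivable A R j"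

text \<open>
  In a coded derivation every judgement carries a time stamp, and its premises must have smaller stamps; this turns
  well-foundedness of the derivation into a local condition on the members of a finite set.
\<close>

definition justified where
  "justified A R D s j \<longleftrightarrow> A j \<or>
    (\<exists>t i t' i'. \<langle>t,i\<rangle> \<in> set_decode D \<and> \<langle>t',i'\<rangle> \<in> set_decode D \<and> t < s \<and> t' < s \<and> R i i' j)"

lemma derivable_iff:
  "derivable A R j \<longleftrightarrow> (\<exists>D s. \<langle>s,j\<rangle> \<in> set_decode D \<and>
     (\<forall>x<D. x \<in> set_decode D \<longrightarrow> justified A R D (pfst x) (psnd x)))"
proof
  assume "derivable A R j"
  then have "\<exists>D s. finite D \<and> \<langle>s,j\<rangle> \<in> D \<and> (\<forall>x\<in>D. A (psnd x) \<or>
    (\<exists>t i t' i'. \<langle>t,i\<rangle> \<in> D \<and> \<langle>t',i'\<rangle> \<in> D \<and> t < pfst x \<and> t' < pfst x \<and> R i i' (psnd x)))"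
    (is "\<exists>D s. ?P D s j")
  proof induction
    case (axiom j)
    then have "?P {\<langle>0,j\<rangle>} 0 j" by auto
    then show ?case by blast
  next
    case (step i i' j)
    then obtain D s D' s' where P: "?P D s i" "?P D' s' i'" by blast
    have "?P (insert \<langle>Suc (s + s'),j\<rangle> (D \<union> D')) (Suc (s + s')) j"
    proof (intro conjI ballI)
      fix x assume x: "x \<in> insert \<langle>Suc (s + s'),j\<rangle> (D \<union> D')"
      show "A (psnd x) \<or> (\<exists>t i t' i'. \<langle>t,i\<rangle> \<in> insert \<langle>Suc (s + s'),j\<rangle> (D \<union> D') \<and>
        \<langle>t',i'\<rangle> \<in> insert \<langle>Suc (s + s'),j\<rangle> (D \<union> D') \<and> t < pfst x \<and> t' < pfst x \<and> R i i' (psnd x))"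
      proof (cases "x = \<langle>Suc (s + s'),j\<rangle>")
        case True
        have "s < pfst x" "s' < pfst x" "R i i' (psnd x)" using True step.hyps(3) by auto
        then show ?thesis using P by blast
      next
        case False
        then have "x \<in> D \<or> x \<in> D'" using x by blast
        then show ?thesis using P by blast
      qed
    qed (use P in auto)
    then show ?case by blast
  qed
  then obtain D s where D: "?P D s j" by blast
  then have "set_decode (set_encode D) = D" by simp
  then show "\<exists>D s. \<langle>s,j\<rangle> \<in> set_decode D \<and>
     (\<forall>x<D. x \<in> set_decode D \<longrightarrow> justified A R D (pfst x) (psnd x))"
    using D unfolding justified_def by metis
next
  assume "\<exists>D s. \<langle>s,j\<rangle> \<in> set_decode D \<and>
     (\<forall>x<D. x \<in> set_decode D \<longrightarrow> justified A R D (pfst x) (psnd x))"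
  then obtain D s where j: "\<langle>s,j\<rangle> \<in> set_decode D"
    and D: "\<And>x. x \<in> set_decode D \<Longrightarrow> justified A R D (pfst x) (psnd x)"
    using less_set_decode by blast
  from j show "derivable A R j"
  proof (induction s arbitrary: j rule: less_induct)
    case (less s)
    then show ?case
      using D[OF less.prems] unfolding justified_def by (auto intro: derivable.intros)
  qed
qed

lemma re_in_derivable:
  assumes A: "re_in J A" and R: "re_in J (\<lambda>z. R (pfst (pfst z)) (psnd (pfst z)) (psnd z))"
  shows "re_in J (derivable A R)"
proof -
  have R': "re_in J (\<lambda>x. R (F x) (G x) (H x))" if "computable F" "computable G" "computable H" for F G H
    using re_in_comp[OF R, of "\<lambda>x. \<langle>\<langle>F x,G x\<rangle>,H x\<rangle>"] that by (simp add: computable_intros)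
  have "re_in J (\<lambda>j. derivable A R j)"
    unfolding derivable_iff justified_def
    by (intro re_in_intros re_in_comp[OF A] R' computable_intros decidable_intros)
  then show ?thesis .
qed

section \<open>A universal c.e. relation and the parameter theorem\<close>

text \<open>
  A program searches for a witness of the normal form; with the empty oracle only the empty finite set is an admissible use.
\<close>

lemma re_in_empty_halting_set:
  assumes "re_in {} P"
  obtains f where "halting_set f = {x. P x}"
proof -
  obtain R where R: "decidable R" "\<And>x. P x \<longleftrightarrow> (\<exists>u w. set_decode u \<subseteq> {} \<and> R \<langle>x,\<langle>u,w\<rangle>\<rangle>)"
    using re_inE[OF assms] by metis
  have P: "P x \<longleftrightarrow> (\<exists>v. set_decode (pfst v) = {} \<and> R \<langle>x,v\<rangle>)" for x
    unfolding R(2) by (metis pair_simps(1,3) subset_empty)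
  have "decidable (\<lambda>z. \<not> ((\<forall>i<pfst (pfst z). \<not> i \<in> set_decode (pfst (pfst z))) \<and> R \<langle>psnd z,pfst z\<rangle>))"
    by (intro decidable_intros decidable_comp[OF R(1)] computable_intros)
  moreover have "(\<forall>i<u. \<not> i \<in> set_decode u) \<longleftrightarrow> set_decode u = {}" for u
    using less_set_decode by blast
  ultimately obtain g where
    g: "\<And>z. computes g [z] (of_bool (\<not> (set_decode (pfst (pfst z)) = {} \<and> R \<langle>psnd z,pfst z\<rangle>)))"
    by (auto simp: decidable_def computable_def)
  let ?f = "Comp g [pair_prog]"
  have f: "computes ?f [v, x] (of_bool (\<not> (set_decode (pfst v) = {} \<and> R \<langle>x,v\<rangle>)))" for v x
    using computes_Comp1[OF computes_pair g] by (simp only: pair_simps)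
  have "x \<in> halting_set (Mu ?f) \<longleftrightarrow> P x" for x
  proof
    assume "x \<in> halting_set (Mu ?f)"
    then obtain v where "computes ?f [v, x] 0"
      by (auto simp: halting_set_def elim: computes_MuE)
    then have "of_bool (\<not> (set_decode (pfst v) = {} \<and> R \<langle>x,v\<rangle>)) = (0::nat)"
      using f computes_deterministic by blast
    then show "P x" by (auto simp: P)
  next
    assume "P x"
    then obtain v where "set_decode (pfst v) = {} \<and> R \<langle>x,v\<rangle>" by (auto simp: P)
    then show "x \<in> halting_set (Mu ?f)"
      unfolding halting_set_def using computes_Mu_Least[where xs = "[x]", OF f, of v] by auto
  qed
  then have "halting_set (Mu ?f) = {x. P x}" by blast
  then show ?thesis by (rule that)
qed

lemma re_in_empty_imp_ce: "re_in {} P \<Longrightarrow> ce {x. P x}"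
  by (metis ce_def re_in_empty_halting_set)

text \<open>
  The judgements of the evaluation system. \<open>ev e a y\<close>: program \<open>e\<close> on argument list
  \<open>a\<close> has value \<open>y\<close>; \<open>evs g a b\<close>: the list \<open>g\<close> of programs on
  \<open>a\<close> has the list \<open>b\<close> of values; \<open>nz e a y\<close>: program \<open>e\<close> has a nonzero
  value on \<open>z\<close> followed by \<open>a\<close>, for all \<open>z < y\<close>. The last two cut the rules for
  composition and minimisation down to two premises each.
\<close>

abbreviation ev :: "nat \<Rightarrow> nat \<Rightarrow> nat \<Rightarrow> nat" where "ev e a y \<equiv> \<langle>0,\<langle>e,\<langle>a,y\<rangle>\<rangle>\<rangle>"
abbreviation evs :: "nat \<Rightarrow> nat \<Rightarrow> nat \<Rightarrow> nat" where "evs g a b \<equiv> \<langle>1,\<langle>g,\<langle>a,b\<rangle>\<rangle>\<rangle>"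
abbreviation nz :: "nat \<Rightarrow> nat \<Rightarrow> nat \<Rightarrow> nat" where "nz e a y \<equiv> \<langle>2,\<langle>e,\<langle>a,y\<rangle>\<rangle>\<rangle>"
abbreviation cons :: "nat \<Rightarrow> nat \<Rightarrow> nat" where "cons x a \<equiv> Suc \<langle>x,a\<rangle>"

definition eval_axiom :: "nat \<Rightarrow> bool" where
  "eval_axiom j \<longleftrightarrow>
    (\<exists>a. j = ev \<langle>0,0\<rangle> a 0) \<or>
    (\<exists>x a. j = ev \<langle>1,0\<rangle> (cons x a) (Suc x)) \<or>
    (\<exists>x a. j = ev \<langle>2,0\<rangle> (cons x a) x) \<or>
    (\<exists>a. j = evs 0 a 0) \<or>
    (\<exists>e a. j = nz e a 0)"

definition eval_rule :: "nat \<Rightarrow> nat \<Rightarrow> nat \<Rightarrow> bool" where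
  "eval_rule i i' j \<longleftrightarrow>
    (\<exists>k x a y. i = ev \<langle>2,k\<rangle> a y \<and> j = ev \<langle>2,Suc k\<rangle> (cons x a) y) \<or>
    (\<exists>e g a b y. i = evs g a b \<and> i' = ev e b y \<and> j = ev \<langle>3,\<langle>e,g\<rangle>\<rangle> a y) \<or>
    (\<exists>e g a b y. i = ev e a y \<and> i' = evs g a b \<and> j = evs (cons e g) a (cons y b)) \<or>
    (\<exists>e e' a y. i = ev e a y \<and> j = ev \<langle>4,\<langle>e,e'\<rangle>\<rangle> (cons 0 a) y) \<or>
    (\<exists>e e' n r a y. i = ev \<langle>4,\<langle>e,e'\<rangle>\<rangle> (cons n a) r \<and> i' = ev e' (cons n (cons r a)) y \<and>
      j = ev \<langle>4,\<langle>e,e'\<rangle>\<rangle> (cons (Suc n) a) y) \<or>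
    (\<exists>e a y v. i = nz e a y \<and> i' = ev e (cons y a) (Suc v) \<and> j = nz e a (Suc y)) \<or>
    (\<exists>e a y. i = nz e a y \<and> i' = ev e (cons y a) 0 \<and> j = ev \<langle>5,e\<rangle> a y)"

abbreviation evaluates :: "nat \<Rightarrow> bool" where "evaluates \<equiv> derivable eval_axiom eval_rule"

lemma re_in_evaluates: "re_in J evaluates"
proof (rule re_in_derivable)
  show "re_in J eval_axiom"
    unfolding eval_axiom_def by (intro re_in_intros computable_intros)
  show "re_in J (\<lambda>z. eval_rule (pfst (pfst z)) (psnd (pfst z)) (psnd z))"
    unfolding eval_rule_def by (intro re_in_intros computable_intros)
qed

text \<open>
  Numbers that are not codes of programs may occur in derivations; soundness is therefore stated for those judgements whose
  program component is a code, and is vacuous otherwise.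
\<close>

definition sound :: "nat \<Rightarrow> bool" where
  "sound j \<longleftrightarrow>
    (\<forall>f a y. j = ev (code f) a y \<longrightarrow> computes f (list_decode a) y) \<and>
    (\<forall>gs a b. j = evs (list_encode (map code gs)) a b \<longrightarrow>
      list_all2 (\<lambda>g y. computes g (list_decode a) y) gs (list_decode b)) \<and>
    (\<forall>f a y. j = nz (code f) a y \<longrightarrow> (\<forall>z<y. \<exists>v. computes f (z # list_decode a) (Suc v)))"

lemma code_cases:
  "code f = \<langle>0,0\<rangle> \<longleftrightarrow> f = Zero"
  "code f = \<langle>1,0\<rangle> \<longleftrightarrow> f = Succ"
  "code f = \<langle>2,k\<rangle> \<longleftrightarrow> f = Proj k"
  "code f = \<langle>3,\<langle>e,g\<rangle>\<rangle> \<longleftrightarrow> (\<exists>h hs. f = Comp h hs \<and> e = code h \<and> g = list_encode (map code hs))"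
  "code f = \<langle>4,\<langle>e,e'\<rangle>\<rangle> \<longleftrightarrow> (\<exists>g h. f = PrimRec g h \<and> e = code g \<and> e' = code h)"
  "code f = \<langle>5,e\<rangle> \<longleftrightarrow> (\<exists>g. f = Mu g \<and> e = code g)"
  by (cases f; auto)+

lemma list_encode_cons: "list_encode (map code gs) = cons e g \<longleftrightarrow>
  (\<exists>h hs. gs = h # hs \<and> e = code h \<and> g = list_encode (map code hs))"
  by (cases gs) auto

lemma list_encode_0: "list_encode (map code gs) = 0 \<longleftrightarrow> gs = []"
  by (cases gs) auto

lemma sound_ev: "sound (ev e a y) \<longleftrightarrow> (\<forall>f. code f = e \<longrightarrow> computes f (list_decode a) y)"
  by (auto simp: sound_def)

lemma sound_evs: "sound (evs g a b) \<longleftrightarrow> (\<forall>gs. list_encode (map code gs) = g \<longrightarrow>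
    list_all2 (\<lambda>g y. computes g (list_decode a) y) gs (list_decode b))"
  by (auto simp: sound_def)

lemma sound_nz: "sound (nz e a y) \<longleftrightarrow>
    (\<forall>f. code f = e \<longrightarrow> (\<forall>z<y. \<exists>v. computes f (z # list_decode a) (Suc v)))"
  by (auto simp: sound_def)

lemmas sound_iffs = sound_ev sound_evs sound_nz

lemma evaluates_sound: "evaluates j \<Longrightarrow> sound j"
proof (induction rule: derivable.induct)
  case (axiom j)
  then show ?case
    unfolding eval_axiom_def
    by (elim disjE exE) (auto simp only: sound_iffs code_cases list_encode_0 list_decode.simps
        prod_encode_inverse prod.case list_all2_Nil
        intro!: computes.Zero computes.Succ computes_Proj_eq, auto)
next
  case (step i i' j)
  from step.hyps(3) show ?case
    unfolding eval_rule_def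
  proof (elim disjE exE conjE)
    fix k x a y assume "i = ev \<langle>2,k\<rangle> a y" and j: "j = ev \<langle>2,Suc k\<rangle> (cons x a) y"
    then have "computes (Proj k) (list_decode a) y"
      using step.IH(1) by (simp add: sound_ev code_cases)
    then have "computes (Proj (Suc k)) (x # list_decode a) y"
      by (auto elim!: computes_ProjE intro!: computes_Proj_eq)
    then show ?thesis unfolding j by (simp add: sound_ev code_cases)
  next
    fix e g a b y assume *: "i = evs g a b" "i' = ev e b y" and j: "j = ev \<langle>3,\<langle>e,g\<rangle>\<rangle> a y"
    from step.IH[unfolded *] show ?thesis
      unfolding j sound_iffs code_cases by (blast intro: computes.Comp)
  next
    fix e g a b y assume *: "i = ev e a y" "i' = evs g a b" and j: "j = evs (cons e g) a (cons y b)"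
    from step.IH[unfolded *] show ?thesis
      unfolding j sound_iffs list_encode_cons by auto
  next
    fix e e' a y assume *: "i = ev e a y" and j: "j = ev \<langle>4,\<langle>e,e'\<rangle>\<rangle> (cons 0 a) y"
    from step.IH(1)[unfolded *] show ?thesis
      unfolding j sound_iffs code_cases by (auto intro: computes.PrimRec_0)
  next
    fix e e' n r a y assume *: "i = ev \<langle>4,\<langle>e,e'\<rangle>\<rangle> (cons n a) r" "i' = ev e' (cons n (cons r a)) y"
      and j: "j = ev \<langle>4,\<langle>e,e'\<rangle>\<rangle> (cons (Suc n) a) y"
    from step.IH[unfolded *] show ?thesis
      unfolding j sound_iffs code_cases by (auto intro!: computes.PrimRec_Suc)
  next
    fix e a y v assume *: "i = nz e a y" "i' = ev e (cons y a) (Suc v)" and j: "j = nz e a (Suc y)"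
    from step.IH[unfolded *] show ?thesis
      unfolding j sound_iffs by (auto simp: less_Suc_eq)
  next
    fix e a y assume *: "i = nz e a y" "i' = ev e (cons y a) 0" and j: "j = ev \<langle>5,e\<rangle> a y"
    from step.IH[unfolded *] show ?thesis
      unfolding j sound_iffs code_cases by (auto intro!: computes.Mu)
  qed
qed

lemma computes_evaluates: "computes f xs y \<Longrightarrow> evaluates (ev (code f) (list_encode xs) y)"
proof (induction rule: computes.induct)
  case (Zero xs)
  show ?case by (rule derivable.axiom) (simp add: eval_axiom_def)
next
  case (Succ x xs)
  show ?case by (rule derivable.axiom) (simp add: eval_axiom_def)
next
  case (Proj i xs)
  then show ?case
  proof (induction i arbitrary: xs)
    case 0
    then obtain x xs' where "xs = x # xs'" by (cases xs) auto
    then show ?case by (auto intro!: derivable.axiom simp: eval_axiom_def)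
  next
    case (Suc i)
    then obtain x xs' where xs: "xs = x # xs'" by (cases xs) auto
    have *: "evaluates (ev (code (recf.Proj i)) (list_encode xs') (xs' ! i))"
      by (rule Suc.IH) (use Suc.prems xs in simp)
    show ?case by (rule derivable.step[OF * *]) (auto simp: eval_rule_def xs)
  qed
next
  case (Comp xs gs ys f z)
  have "evaluates (evs (list_encode (map code gs)) (list_encode xs) (list_encode ys))"
    using Comp.IH(1)
  proof (induction rule: list_all2_induct)
    case Nil
    show ?case by (rule derivable.axiom) (simp add: eval_axiom_def)
  next
    case (Cons g gs y ys)
    show ?case
      by (rule derivable.step[OF conjunct2[OF Cons(1)] Cons(3)]) (auto simp: eval_rule_def)
  qed
  then show ?case
    by (rule derivable.step[OF _ Comp.IH(2)]) (auto simp: eval_rule_def)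
next
  case (PrimRec_0 f xs y g)
  show ?case
    by (rule derivable.step[OF PrimRec_0.IH PrimRec_0.IH]) (auto simp: eval_rule_def)
next
  case (PrimRec_Suc f g n xs r y)
  show ?case
    by (rule derivable.step[OF PrimRec_Suc.IH]) (auto simp: eval_rule_def)
next
  case (Mu f y xs)
  have "evaluates (nz (code f) (list_encode xs) m)" if "m \<le> y" for m
    using that
  proof (induction m)
    case 0
    show ?case by (rule derivable.axiom) (simp add: eval_axiom_def)
  next
    case (Suc m)
    then obtain v where v: "evaluates (ev (code f) (list_encode (m # xs)) (Suc v))"
      using Mu.IH(2) by (meson Suc_le_eq)
    have "evaluates (nz (code f) (list_encode xs) m)" using Suc by simp
    from this v show ?case by (rule derivable.step) (auto simp: eval_rule_def)
  qed
  from derivable.step[OF this[OF order_refl] Mu.IH(1)] show ?case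
    by (auto simp: eval_rule_def)
qed

text \<open>
  Since evaluation is sound for genuine codes only, the universal relation also has to recognise codes. Tag 0 marks codes of
  programs and tag 1 codes of lists of programs.
\<close>

definition code_axiom :: "nat \<Rightarrow> bool" where
  "code_axiom j \<longleftrightarrow> j = \<langle>0,\<langle>0,0\<rangle>\<rangle> \<or> j = \<langle>0,\<langle>1,0\<rangle>\<rangle> \<or> (\<exists>k. j = \<langle>0,\<langle>2,k\<rangle>\<rangle>) \<or> j = \<langle>1,0\<rangle>"

definition code_rule :: "nat \<Rightarrow> nat \<Rightarrow> nat \<Rightarrow> bool" where
  "code_rule i i' j \<longleftrightarrow>
    (\<exists>e g. i = \<langle>0,e\<rangle> \<and> i' = \<langle>1,g\<rangle> \<and> (j = \<langle>0,\<langle>3,\<langle>e,g\<rangle>\<rangle>\<rangle> \<or> j = \<langle>1,cons e g\<rangle>)) \<or>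
    (\<exists>e e'. i = \<langle>0,e\<rangle> \<and> i' = \<langle>0,e'\<rangle> \<and> (j = \<langle>0,\<langle>4,\<langle>e,e'\<rangle>\<rangle>\<rangle> \<or> j = \<langle>0,\<langle>5,e\<rangle>\<rangle>))"

lemma derivable_code_iff: "derivable code_axiom code_rule \<langle>0,e\<rangle> \<longleftrightarrow> e \<in> range code"
proof
  have "(\<forall>e. j = \<langle>0,e\<rangle> \<longrightarrow> e \<in> range code) \<and>
      (\<forall>g. j = \<langle>1,g\<rangle> \<longrightarrow> g \<in> range (\<lambda>gs. list_encode (map code gs)))"
    if "derivable code_axiom code_rule j" for j
    using that
  proof induction
    case (axiom j)
    have "\<langle>0,0\<rangle> \<in> range code" "\<langle>1,0\<rangle> \<in> range code" "\<And>k. \<langle>2,k\<rangle> \<in> range code"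
      "0 \<in> range (\<lambda>gs. list_encode (map code gs))"
      by (metis code.simps(1) rangeI, metis code.simps(2) rangeI, metis code.simps(3) rangeI,
          metis list_encode.simps(1) list.map(1) rangeI)
    then show ?case using axiom unfolding code_axiom_def by (elim disjE exE) simp_all
  next
    case (step i i' j)
    have eqs: "\<langle>3,\<langle>code f,list_encode (map code gs)\<rangle>\<rangle> = code (Comp f gs)"
      "\<langle>4,\<langle>code f,code g\<rangle>\<rangle> = code (PrimRec f g)" "\<langle>5,code f\<rangle> = code (Mu f)"
      "cons (code f) (list_encode (map code gs)) = list_encode (map code (f # gs))" for f g gs
      by auto
    from step.hyps(3) step.IH show ?case unfolding code_rule_def
      by (auto simp del: code.simps list.simps list_encode.simps simp: eqs)
  qed
  then show "derivable code_axiom code_rule \<langle>0,e\<rangle> \<Longrightarrow> e \<in> range code" by blast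
next
  let ?d = "derivable code_axiom code_rule"
  have "?d \<langle>0,code f\<rangle>" for f
  proof (induction f)
    case (Comp f gs)
    have "?d \<langle>1,list_encode (map code gs)\<rangle>"
      using Comp.IH(2)
    proof (induction gs)
      case Nil
      show ?case by (rule derivable.axiom) (simp add: code_axiom_def)
    next
      case (Cons g gs)
      have "?d \<langle>0,code g\<rangle>" "?d \<langle>1,list_encode (map code gs)\<rangle>" using Cons by auto
      then show ?case by (rule derivable.step) (auto simp: code_rule_def)
    qed
    with Comp.IH(1) show ?case by (rule derivable.step) (auto simp: code_rule_def)
  next
    case (PrimRec f g)
    then show ?case by (rule derivable.step) (auto simp: code_rule_def)
  next
    case (Mu f)
    from Mu Mu show ?case by (rule derivable.step) (auto simp: code_rule_def)
  qed (auto intro!: derivable.axiom simp: code_axiom_def)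
  then show "e \<in> range code \<Longrightarrow> ?d \<langle>0,e\<rangle>" by blast
qed

lemma W_iff: "x \<in> W e \<longleftrightarrow> derivable code_axiom code_rule \<langle>0,e\<rangle> \<and> (\<exists>y. evaluates (ev e (cons x 0) y))"
proof -
  have "computes f [x] y \<longleftrightarrow> evaluates (ev (code f) (cons x 0) y)" for f y
    using computes_evaluates[of f "[x]" y] evaluates_sound[of "ev (code f) (cons x 0) y"]
    by (auto simp: sound_def)
  then show ?thesis by (auto simp: W_def halting_set_def derivable_code_iff)
qed

text \<open>
  The universal c.e. relation: membership of \<open>x\<close> in \<open>W e\<close> is c.e. in both arguments at once.
\<close>

theorem re_in_W: "computable F \<Longrightarrow> computable E \<Longrightarrow> re_in J (\<lambda>x. F x \<in> W (E x))"
proof -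
  assume F: "computable F" and E: "computable E"
  have "re_in J (derivable code_axiom code_rule)"
  proof (rule re_in_derivable)
    show "re_in J code_axiom"
      unfolding code_axiom_def by (intro re_in_intros computable_intros)
    show "re_in J (\<lambda>z. code_rule (pfst (pfst z)) (psnd (pfst z)) (psnd z))"
      unfolding code_rule_def by (intro re_in_intros computable_intros)
  qed
  note re_code = re_in_comp[OF this]
  show ?thesis
    unfolding W_iff
    by (intro re_in_intros re_code re_in_comp[OF re_in_evaluates] computable_intros
        computable_comp[OF F] computable_comp[OF E])
qed

lemma ce_iff: "ce X \<longleftrightarrow> re_in {} (\<lambda>x. x \<in> X)"
proof
  assume "ce X"
  then obtain e where "X = W e" using range_W by blast
  moreover have "re_in {} (\<lambda>x. x \<in> W e)" by (intro re_in_W computable_intros)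
  ultimately show "re_in {} (\<lambda>x. x \<in> X)" by simp
next
  assume "re_in {} (\<lambda>x. x \<in> X)"
  from re_in_empty_imp_ce[OF this] show "ce X" by simp
qed

lemma computable_code_const_prog: "computable (\<lambda>x. code (const_prog x))"
proof -
  have "code (const_prog n) = rec_nat \<langle>0,0\<rangle> (\<lambda>k r. \<langle>3,\<langle>\<langle>1,0\<rangle>,cons r 0\<rangle>\<rangle>) n" for n
    by (induction n) auto
  moreover have "computable (\<lambda>x. rec_nat \<langle>0,0\<rangle> (\<lambda>k r. \<langle>3,\<langle>\<langle>1,0\<rangle>,cons r 0\<rangle>\<rangle>) x)"
    by (intro computable_rec_nat computable_intros)
  ultimately show ?thesis by simp
qed

text \<open>
  The parameter theorem: a section of a c.e. relation has an index computable from the parameter, namely the code of the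
  composition with a program for the constant \<open>x\<close>.
\<close>

theorem parameter_theorem:
  assumes "re_in {} (\<lambda>z. P (pfst z) (psnd z))"
  obtains h where "computable h" "\<And>x. W (h x) = {y. P x y}"
proof -
  obtain g where g: "halting_set g = {z. P (pfst z) (psnd z)}"
    using re_in_empty_halting_set[OF assms] .
  let ?q = "\<lambda>x. Comp pair_prog [const_prog x, Proj 0]"
  let ?h = "\<lambda>x. code (Comp g [?q x])"
  have q: "computes (?q x) [y] \<langle>x,y\<rangle>" for x y
    by (rule computes_Comp2[OF computes_const computes_Proj_eq computes_pair]) simp_all
  have "computable ?h"
    unfolding code.simps list.map list_encode.simps
    by (intro computable_intros computable_comp[OF computable_code_const_prog])
  moreover have "W (?h x) = {y. P x y}" for x
  proof -
    have "y \<in> halting_set (Comp g [?q x]) \<longleftrightarrow> \<langle>x,y\<rangle> \<in> halting_set g" for y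
    proof
      assume "y \<in> halting_set (Comp g [?q x])"
      then obtain v z where "computes (?q x) [y] v" "computes g [v] z"
        by (auto simp: halting_set_def list_all2_Cons1 elim!: computes_CompE[of g])
      then show "\<langle>x,y\<rangle> \<in> halting_set g"
        using computes_deterministic[OF q] by (auto simp: halting_set_def)
    next
      assume "\<langle>x,y\<rangle> \<in> halting_set g"
      then show "y \<in> halting_set (Comp g [?q x])"
        by (auto simp: halting_set_def intro: computes_Comp1[OF q])
    qed
    then show ?thesis unfolding W_code by (auto simp: g)
  qed
  ultimately show ?thesis by (rule that)
qed

section \<open>Enumeration reducibility and the jump\<close>

text \<open>
  The bridge to enumeration operators: the c.e. set of an operator is the projection of the normal form along the witness
  \<open>w\<close>.
\<close>

lemma enum_le_iff: "A \<le>\<^sub>e B \<longleftrightarrow> re_in B (\<lambda>x. x \<in> A)"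
proof
  assume "A \<le>\<^sub>e B"
  then obtain V where V: "ce V" "A = enum_op V B"
    by (auto simp: enum_le_def enumeration_operator_def)
  have "x \<in> A \<longleftrightarrow> (\<exists>u. \<langle>x,u\<rangle> \<in> V \<and> (\<forall>i<u. i \<in> set_decode u \<longrightarrow> i \<in> B))" for x
    unfolding V(2) enum_op_def using less_set_decode by blast
  moreover have "re_in B (\<lambda>x. \<exists>u. \<langle>x,u\<rangle> \<in> V \<and> (\<forall>i<u. i \<in> set_decode u \<longrightarrow> i \<in> B))"
    by (intro re_in_intros re_in_comp[OF re_in_mono[OF V(1)[unfolded ce_iff]]] re_in_member
        computable_intros decidable_intros)
  ultimately show "re_in B (\<lambda>x. x \<in> A)" by simp
next
  assume "re_in B (\<lambda>x. x \<in> A)"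
  then obtain R where R: "decidable R" "\<And>x. x \<in> A \<longleftrightarrow> (\<exists>u w. set_decode u \<subseteq> B \<and> R \<langle>x,\<langle>u,w\<rangle>\<rangle>)"
    using re_inE by metis
  have "ce {z. \<exists>w. R \<langle>pfst z,\<langle>psnd z,w\<rangle>\<rangle>}"
    by (intro re_in_empty_imp_ce re_in_ex re_in_decidable decidable_comp[OF R(1)] computable_intros)
  moreover have "A = enum_op {z. \<exists>w. R \<langle>pfst z,\<langle>psnd z,w\<rangle>\<rangle>} B"
    unfolding set_eq_iff enum_op_def R(2) mem_Collect_eq pair_simps by blast
  ultimately show "A \<le>\<^sub>e B" unfolding enum_le_def enumeration_operator_def by blast
qed

lemma re_in_trans:
  assumes "re_in B P" "B \<le>\<^sub>e J" shows "re_in J P"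
proof -
  obtain R where R: "decidable R" "\<And>x. P x \<longleftrightarrow> (\<exists>u w. set_decode u \<subseteq> B \<and> R \<langle>x,\<langle>u,w\<rangle>\<rangle>)"
    using re_inE[OF assms(1)] by metis
  have "P x \<longleftrightarrow> (\<exists>u. \<exists>w. (\<forall>i<u. i \<in> set_decode u \<longrightarrow> i \<in> B) \<and> R \<langle>x,\<langle>u,w\<rangle>\<rangle>)" for x
    unfolding R(2) using less_set_decode by blast
  moreover have "re_in J (\<lambda>x. \<exists>u. \<exists>w. (\<forall>i<u. i \<in> set_decode u \<longrightarrow> i \<in> B) \<and> R \<langle>x,\<langle>u,w\<rangle>\<rangle>)"
    by (intro re_in_intros re_in_comp[OF assms(2)[unfolded enum_le_iff]]
        re_in_comp[OF re_in_decidable[OF R(1)]] computable_intros decidable_intros)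
  ultimately have "re_in J (\<lambda>x. P x)" by presburger
  then show ?thesis .
qed

lemma join_iff [simp]: "2 * x \<in> A \<oplus> B \<longleftrightarrow> x \<in> A" "Suc (2 * x) \<in> A \<oplus> B \<longleftrightarrow> x \<in> B"
  unfolding join_def by (auto; presburger)+

lemma mem_join: "x \<in> A \<oplus> B \<longleftrightarrow> (\<exists>y. x = 2 * y \<and> y \<in> A \<or> x = Suc (2 * y) \<and> y \<in> B)"
  unfolding join_def by auto

lemma re_in_join:
  assumes "re_in J (\<lambda>x. x \<in> A)" "re_in J (\<lambda>x. x \<in> B)"
  shows "re_in J (\<lambda>x. x \<in> A \<oplus> B)"
  unfolding mem_join by (intro re_in_intros re_in_comp[OF assms(1)] re_in_comp[OF assms(2)] computable_intros)

lemma le_join: "A \<le>\<^sub>e A \<oplus> B" "B \<le>\<^sub>e A \<oplus> B"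
proof -
  have "re_in (A \<oplus> B) (\<lambda>x. 2 * x \<in> A \<oplus> B)" "re_in (A \<oplus> B) (\<lambda>x. Suc (2 * x) \<in> A \<oplus> B)"
    by (intro re_in_member computable_intros)+
  then show "A \<le>\<^sub>e A \<oplus> B" "B \<le>\<^sub>e A \<oplus> B" by (simp_all add: enum_le_iff)
qed

lemma mem_K: "e \<in> K X \<longleftrightarrow> (\<exists>u. \<langle>e,u\<rangle> \<in> W e \<and> (\<forall>i<u. i \<in> set_decode u \<longrightarrow> i \<in> X))"
  unfolding K_def Phi_def enum_op_def using less_set_decode by blast

lemma re_in_K: "re_in X (\<lambda>e. e \<in> K X)"
  unfolding mem_K by (intro re_in_intros re_in_W re_in_member computable_intros decidable_intros)

text \<open>
  \<open>K X\<close> is many-one complete among the sets enumerable from \<open>X\<close>. The set \<open>W (h x)\<close>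
  pairs every number with every finite set that suffices as oracle for \<open>P x\<close>; applied to \<open>X\<close>, its
  operator enumerates all numbers if \<open>P x\<close> holds and none otherwise, so it does not matter that \<open>K
  X\<close> asks about the number \<open>h x\<close> itself.
\<close>

lemma K_complete:
  assumes "re_in X P"
  obtains h where "computable h" "\<And>x. P x \<longleftrightarrow> h x \<in> K X"
proof -
  obtain R where R: "decidable R" "\<And>x. P x \<longleftrightarrow> (\<exists>u w. set_decode u \<subseteq> X \<and> R \<langle>x,\<langle>u,w\<rangle>\<rangle>)"
    using re_inE[OF assms] by metis
  have "re_in {} (\<lambda>z. \<exists>w. R \<langle>pfst z,\<langle>psnd (psnd z),w\<rangle>\<rangle>)"
    by (intro re_in_ex re_in_decidable decidable_comp[OF R(1)] computable_intros)
  then obtain h where h: "computable h" "\<And>x. W (h x) = {z. \<exists>w. R \<langle>x,\<langle>psnd z,w\<rangle>\<rangle>}"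
    by (rule parameter_theorem) (rule that, assumption+)
  have "P x \<longleftrightarrow> h x \<in> K X" for x
    unfolding R(2) by (auto simp: K_def Phi_def enum_op_def h(2))
  with h(1) show ?thesis by (rule that)
qed

lemma re_in_jump: "re_in X P \<Longrightarrow> re_in (enum_jump X) P"
proof -
  assume "re_in X P"
  moreover have "X \<le>\<^sub>e enum_jump X"
  proof -
    obtain h where h: "computable h" "\<And>x. x \<in> X \<longleftrightarrow> h x \<in> K X"
      using K_complete[OF re_in_member[OF computable_id]] by metis
    have "re_in (enum_jump X) (\<lambda>x. 2 * h x \<in> enum_jump X)"
      by (intro re_in_member computable_intros computable_comp[OF h(1)])
    then show ?thesis by (simp add: enum_le_iff h(2) enum_jump_def)
  qed
  ultimately show ?thesis by (rule re_in_trans)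
qed

lemma re_in_jump_not: "re_in X P \<Longrightarrow> re_in (enum_jump X) (\<lambda>x. \<not> P x)"
proof -
  assume "re_in X P"
  then obtain h where h: "computable h" "\<And>x. P x \<longleftrightarrow> h x \<in> K X" by (rule K_complete) (rule that, assumption+)
  have "re_in (enum_jump X) (\<lambda>x. Suc (2 * h x) \<in> enum_jump X)"
    by (intro re_in_member computable_intros computable_comp[OF h(1)])
  then show ?thesis by (simp add: h(2) enum_jump_def)
qed

lemma enum_jump_leI:
  assumes "re_in J (\<lambda>e. e \<in> K X)" "re_in J (\<lambda>e. e \<notin> K X)"
  shows "enum_jump X \<le>\<^sub>e J"
  using re_in_join[of J "K X" "- K X"] assms by (simp add: enum_le_iff enum_jump_def)

lemma enum_jump_empty_le: "enum_jump {} \<le>\<^sub>e enum_jump X"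
  by (rule enum_jump_leI[OF re_in_jump[OF re_in_mono[OF re_in_K]]
        re_in_jump_not[OF re_in_mono[OF re_in_K]]])

section \<open>Kalimullin pairs and the jump\<close>

definition kalimullin_pair :: "nat set \<Rightarrow> nat set \<Rightarrow> bool" where
  "kalimullin_pair A B \<longleftrightarrow> (\<exists>M. re_in {} (\<lambda>z. M (pfst z) (psnd z)) \<and>
     (\<forall>a b. a \<in> A \<longrightarrow> b \<in> B \<longrightarrow> M a b) \<and> (\<forall>a b. a \<notin> A \<longrightarrow> b \<notin> B \<longrightarrow> \<not> M a b))"

lemma kalimullin_pair_sym: "kalimullin_pair A B \<Longrightarrow> kalimullin_pair B A"
proof -
  assume "kalimullin_pair A B"
  then obtain M where M: "re_in {} (\<lambda>z. M (pfst z) (psnd z))" "\<And>a b. a \<in> A \<Longrightarrow> b \<in> B \<Longrightarrow> M a b"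
    "\<And>a b. a \<notin> A \<Longrightarrow> b \<notin> B \<Longrightarrow> \<not> M a b"
    unfolding kalimullin_pair_def by blast
  have "re_in {} (\<lambda>z. M (psnd z) (pfst z))"
    by (rule re_in_comp2[OF M(1)]) (intro computable_intros)+
  then show ?thesis
    unfolding kalimullin_pair_def using M(2,3) by (intro exI[of _ "\<lambda>a b. M b a"]) blast
qed

text \<open>
  For \<open>b \<in> B\<close> the section \<open>{a. M a b}\<close> contains \<open>A\<close>, for \<open>b \<notin>
  B\<close> it is contained in \<open>A\<close>. An index outside \<open>K (A \<oplus> U)\<close> is therefore recognised by
  one \<open>b \<in> B\<close> whose section, joined with \<open>U\<close>, still does not put the index into
  \<open>K\<close>: without such a \<open>b\<close> the index would enumerate \<open>B\<close> from \<open>U\<close>.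
\<close>

theorem kalimullin_pair_jump:
  assumes pair: "kalimullin_pair A B" and "\<not> B \<le>\<^sub>e U"
    and "A \<le>\<^sub>e J" "B \<le>\<^sub>e J" "enum_jump U \<le>\<^sub>e J"
  shows "enum_jump (A \<oplus> U) \<le>\<^sub>e J"
proof (rule enum_jump_leI)
  have "re_in J (\<lambda>x. x \<in> U)"
    by (rule re_in_trans[OF re_in_jump[OF re_in_member[OF computable_id]] assms(5)])
  then have "A \<oplus> U \<le>\<^sub>e J"
    unfolding enum_le_iff by (intro re_in_join assms(3)[unfolded enum_le_iff])
  then show "re_in J (\<lambda>e. e \<in> K (A \<oplus> U))"
    by (rule re_in_trans[OF re_in_K])
  from pair obtain M where M: "re_in {} (\<lambda>z. M (pfst z) (psnd z))"
    and MAB: "\<And>a b. a \<in> A \<Longrightarrow> b \<in> B \<Longrightarrow> M a b"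
    and MAB': "\<And>a b. a \<notin> A \<Longrightarrow> b \<notin> B \<Longrightarrow> \<not> M a b"
    unfolding kalimullin_pair_def by blast
  define V where "V = (\<lambda>e b. e \<in> K ({a. M a b} \<oplus> U))"
  have M': "re_in U (\<lambda>z. M (F z) (G z))" if "computable F" "computable G" for F G
    using that by (rule re_in_comp2[OF re_in_mono[OF M]])
  have V: "re_in U (\<lambda>z. V (pfst z) (psnd z))"
    unfolding V_def mem_K mem_join mem_Collect_eq
    by (intro re_in_intros re_in_W re_in_member M' computable_intros decidable_intros)
  have K_mono: "e \<in> K (Y \<oplus> U)" if "e \<in> K (X \<oplus> U)" "X \<subseteq> Y" for e X Y
    using that unfolding mem_K mem_join by (metis subsetD)
  have "e \<notin> K (A \<oplus> U) \<longleftrightarrow> (\<exists>b. b \<in> B \<and> \<not> V e b)" for e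
  proof
    assume e: "e \<notin> K (A \<oplus> U)"
    have "\<not> V e b" if "b \<notin> B" for b
      using K_mono[of e "{a. M a b}" A] MAB' that e by (auto simp: V_def)
    moreover have "B \<noteq> {b. V e b}"
    proof
      assume "B = {b. V e b}"
      moreover have "re_in U (\<lambda>b. V e b)"
        by (rule re_in_comp2[OF V]) (intro computable_intros)+
      ultimately show False using \<open>\<not> B \<le>\<^sub>e U\<close> by (simp add: enum_le_iff)
    qed
    ultimately show "\<exists>b. b \<in> B \<and> \<not> V e b" by blast
  next
    assume "\<exists>b. b \<in> B \<and> \<not> V e b"
    then obtain b where "b \<in> B" "\<not> V e b" by blast
    then show "e \<notin> K (A \<oplus> U)"
      using K_mono[of e A "{a. M a b}"] MAB by (auto simp: V_def)
  qed
  moreover have "re_in J (\<lambda>z. \<not> V (pfst z) (psnd z))"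
    by (rule re_in_trans[OF re_in_jump_not[OF V] assms(5)])
  then have "re_in J (\<lambda>e. \<exists>b. b \<in> B \<and> \<not> V e b)"
    by (intro re_in_ex re_in_conj re_in_comp[OF assms(4)[unfolded enum_le_iff]] computable_intros)
  ultimately show "re_in J (\<lambda>e. e \<notin> K (A \<oplus> U))" by simp
qed

section \<open>Lower cuts in the lexicographic order\<close>

text \<open>
  The lexicographic order of characteristic functions: \<open>S \<le> T\<close> iff \<open>S = T\<close> or the least point
  of difference belongs to \<open>T\<close>. This form avoids naming the least point and is decidable on canonical finite
  sets.
\<close>

definition lex_le :: "nat set \<Rightarrow> nat set \<Rightarrow> bool" where
  "lex_le S T \<longleftrightarrow> (\<forall>i. i \<in> S \<and> i \<notin> T \<longrightarrow> (\<exists>j<i. j \<in> T \<and> j \<notin> S))"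

lemma lex_le_total: "lex_le S T \<or> lex_le T S"
proof (rule disjCI)
  assume "\<not> lex_le T S"
  then obtain i where i: "i \<in> T" "i \<notin> S" "\<And>j. j < i \<Longrightarrow> j \<in> S \<Longrightarrow> j \<in> T"
    unfolding lex_le_def by blast
  show "lex_le S T"
    unfolding lex_le_def
  proof (intro allI impI)
    fix k assume k: "k \<in> S \<and> k \<notin> T"
    then have "\<not> k < i" "k \<noteq> i" using i by blast+
    then show "\<exists>j<k. j \<in> T \<and> j \<notin> S" using i by (intro exI[of _ i]) auto
  qed
qed

text \<open>
  At the least \<open>m\<close> where the three sets do not all agree, no step down is possible, so \<open>m\<close> belongs
  to \<open>U\<close> and not to \<open>S\<close>.
\<close>

lemma lex_le_trans:
  assumes "lex_le S T" "lex_le T U" shows "lex_le S U"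
  unfolding lex_le_def
proof (intro allI impI)
  fix i assume i: "i \<in> S \<and> i \<notin> U"
  let ?P = "\<lambda>j. (j \<in> S \<longleftrightarrow> j \<notin> T) \<or> (j \<in> T \<longleftrightarrow> j \<notin> U)"
  define m where "m = (LEAST j. ?P j)"
  have "?P i" using i by blast
  then have m: "?P m" "m \<le> i" unfolding m_def by (rule LeastI, rule Least_le)
  have "\<not> ?P j" if "j < m" for j using that unfolding m_def by (rule not_less_Least)
  then have "\<not> (m \<in> S \<and> m \<notin> T)" "\<not> (m \<in> T \<and> m \<notin> U)"
    using assms unfolding lex_le_def by blast+
  then have "m \<in> U" "m \<notin> S" using m(1) by blast+
  moreover have "m \<noteq> i" using \<open>m \<in> U\<close> i by blast
  ultimately show "\<exists>j<i. j \<in> U \<and> j \<notin> S" using m(2) by (metis le_neq_implies_less)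
qed

definition lower_cut :: "nat set \<Rightarrow> nat set" where
  "lower_cut X = {u. lex_le (set_decode u) X}"

lemma lex_le_set_decode:
  "lex_le (set_decode a) (set_decode b) \<longleftrightarrow>
    (\<forall>i<a. i \<in> set_decode a \<and> i \<notin> set_decode b \<longrightarrow> (\<exists>j<i. j \<in> set_decode b \<and> j \<notin> set_decode a))"
  unfolding lex_le_def using less_set_decode by blast

text \<open>
  The comparison itself serves as the c.e. relation: by totality an element below \<open>X\<close> is below one that is not,
  and by transitivity nothing outside a cut is below an element of the cut.
\<close>

lemma kalimullin_pair_lower_cut: "kalimullin_pair (lower_cut X) (- lower_cut X)"
  unfolding kalimullin_pair_def
proof (intro exI conjI allI impI)
  let ?M = "\<lambda>a b. lex_le (set_decode a) (set_decode b)"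
  show "re_in {} (\<lambda>z. ?M (pfst z) (psnd z))"
    unfolding lex_le_set_decode
    by (intro re_in_decidable decidable_intros computable_intros)
  show "?M a b" if "a \<in> lower_cut X" "b \<in> - lower_cut X" for a b
    using that lex_le_total[of "set_decode a" "set_decode b"] lex_le_trans[of "set_decode b" _ X]
    unfolding lower_cut_def by blast
  show "\<not> ?M a b" if "a \<notin> lower_cut X" "b \<notin> - lower_cut X" for a b
    using that lex_le_trans[of "set_decode a" _ X] unfolding lower_cut_def by blast
qed

section \<open>A diagonal cut below the jump\<close>

text \<open>
  Bit \<open>2 * m\<close> makes the lower cut differ from \<open>W m\<close>, and bit \<open>2 * m + 1\<close> makes its
  complement differ from \<open>W m\<close>. The number \<open>t\<close> is the code at which the difference is to occur.
\<close>

definition diag_bit :: "nat \<Rightarrow> nat \<Rightarrow> bool" where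
  "diag_bit n t \<longleftrightarrow> (t \<in> W (n div 2) \<longleftrightarrow> odd n)"

primrec stage :: "nat \<Rightarrow> nat set" where
  "stage 0 = {}"
| "stage (Suc n) = stage n \<union> {i. i = n \<and> diag_bit n (set_encode (insert n (stage n)))}"

definition diag :: "nat set" where
  "diag = {n. diag_bit n (set_encode (insert n (stage n)))}"

lemma stage_eq: "stage n = diag \<inter> {..<n}"
proof (induction n)
  case (Suc n)
  have "{i. i = n \<and> diag_bit n (set_encode (insert n (stage n)))} = diag \<inter> {n}"
    unfolding diag_def by blast
  then have "stage (Suc n) = stage n \<union> diag \<inter> {n}" by (simp only: stage.simps)
  then show ?case unfolding Suc.IH lessThan_Suc by blast
qed simp

definition probe :: "nat \<Rightarrow> nat" where
  "probe n = set_encode (insert n (diag \<inter> {..<n}))"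

lemma mem_diag: "n \<in> diag \<longleftrightarrow> diag_bit n (probe n)"
  by (subst diag_def) (simp add: probe_def stage_eq)

text \<open>
  The bits of the probe below \<open>n\<close> are those of \<open>diag\<close>, and its last element is \<open>n\<close>; so
  it lies below \<open>diag\<close> exactly when \<open>n \<in> diag\<close>. This is why one bit controls membership of one
  number in the cut.
\<close>

lemma probe_in_lower_cut: "probe n \<in> lower_cut diag \<longleftrightarrow> n \<in> diag"
proof -
  have "set_decode (probe n) = insert n (diag \<inter> {..<n})"
    unfolding probe_def by (intro set_encode_inverse) simp
  then show ?thesis unfolding lower_cut_def lex_le_def by auto
qed

lemma lower_cut_diag_not_ce: "\<not> ce (lower_cut diag)" "\<not> ce (- lower_cut diag)"
proof -
  have "lower_cut diag \<noteq> W m" "- lower_cut diag \<noteq> W m" for m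
    using probe_in_lower_cut[of "2 * m"] probe_in_lower_cut[of "2 * m + 1"]
    by (auto simp: mem_diag diag_bit_def)
  then show "\<not> ce (lower_cut diag)" "\<not> ce (- lower_cut diag)" using range_W by blast+
qed

text \<open>
  A description of the initial segments of \<open>diag\<close> in which \<open>W\<close> occurs both positively and
  negatively, but only under bounded universal and existential quantifiers; hence it is enumerable from the jump. The
  existentially bound \<open>t\<close> is the probe at \<open>i\<close>.
\<close>

definition is_stage :: "nat \<Rightarrow> nat \<Rightarrow> bool" where
  "is_stage n s \<longleftrightarrow> (\<forall>i<s. i \<in> set_decode s \<longrightarrow> i < n) \<and>
    (\<forall>i<n. \<exists>t. (\<forall>k<Suc (t + s + i). k \<in> set_decode t \<longleftrightarrow> k = i \<or> k \<in> set_decode s \<and> k < i) \<and>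
      (i \<in> set_decode s \<and> diag_bit i t \<or> i \<notin> set_decode s \<and> \<not> diag_bit i t))"

lemma is_stage_iff: "is_stage n s \<longleftrightarrow> set_decode s = diag \<inter> {..<n}"
proof -
  \<comment> \<open>The bound on \<open>k\<close> exceeds all elements of both finite sets that are compared, so \<open>t\<close> is pinned down.\<close>
  have eq: "(\<forall>k<Suc (t + s + i). k \<in> set_decode t \<longleftrightarrow> k = i \<or> k \<in> set_decode s \<and> k < i) \<longleftrightarrow>
      t = set_encode (insert i (set_decode s \<inter> {..<i}))" for t i
  proof -
    have "(\<forall>k<Suc (t + s + i). k \<in> set_decode t \<longleftrightarrow> k = i \<or> k \<in> set_decode s \<and> k < i) \<longleftrightarrow>
        set_decode t = insert i (set_decode s \<inter> {..<i})"
    proof -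
      have "k \<notin> set_decode t \<and> \<not> (k = i \<or> k \<in> set_decode s \<and> k < i)" if "\<not> k < Suc (t + s + i)" for k
        using that less_set_decode[of k t] by auto
      then show ?thesis unfolding set_eq_iff insert_iff Int_iff lessThan_iff by blast
    qed
    also have "\<dots> \<longleftrightarrow> t = set_encode (insert i (set_decode s \<inter> {..<i}))"
      by (metis finite_Int finite_insert finite_lessThan set_decode_inverse set_encode_inverse)
    finally show ?thesis .
  qed
  have "is_stage n s \<longleftrightarrow> set_decode s \<subseteq> {..<n} \<and>
      (\<forall>i<n. i \<in> set_decode s \<longleftrightarrow> diag_bit i (set_encode (insert i (set_decode s \<inter> {..<i}))))"
  proof -
    have "(\<forall>i<s. i \<in> set_decode s \<longrightarrow> i < n) \<longleftrightarrow> set_decode s \<subseteq> {..<n}"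
      using less_set_decode by blast
    then show ?thesis unfolding is_stage_def eq by auto
  qed
  also have "\<dots> \<longleftrightarrow> set_decode s = diag \<inter> {..<n}"
  proof
    assume s: "set_decode s \<subseteq> {..<n} \<and>
      (\<forall>i<n. i \<in> set_decode s \<longleftrightarrow> diag_bit i (set_encode (insert i (set_decode s \<inter> {..<i}))))"
    have "i < n \<Longrightarrow> i \<in> set_decode s \<longleftrightarrow> i \<in> diag" for i
    proof (induction i rule: less_induct)
      case (less i)
      then have "set_decode s \<inter> {..<i} = diag \<inter> {..<i}" by auto
      then show ?case using s less.prems by (simp add: mem_diag probe_def)
    qed
    then show "set_decode s = diag \<inter> {..<n}" using s by auto
  next
    assume s: "set_decode s = diag \<inter> {..<n}"
    show "set_decode s \<subseteq> {..<n} \<and>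
      (\<forall>i<n. i \<in> set_decode s \<longleftrightarrow> diag_bit i (set_encode (insert i (set_decode s \<inter> {..<i}))))"
    proof (intro conjI allI impI)
      show "set_decode s \<subseteq> {..<n}" using s by blast
      fix i assume i: "i < n"
      then have "{..<i} \<subseteq> {..<n}" by simp
      then have eq: "set_decode s \<inter> {..<i} = diag \<inter> {..<i}"
        unfolding s Int_assoc by (simp only: Int_absorb1)
      have "i \<in> set_decode s \<longleftrightarrow> i \<in> diag" unfolding s using i by simp
      then show "i \<in> set_decode s \<longleftrightarrow> diag_bit i (set_encode (insert i (set_decode s \<inter> {..<i})))"
        unfolding eq using mem_diag[of i, unfolded probe_def] by blast
    qed
  qed
  finally show ?thesis .
qed

lemma re_in_is_stage:
  assumes F: "computable F" and G: "computable G"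
  shows "re_in (enum_jump {}) (\<lambda>x. is_stage (F x) (G x))"
proof -
  let ?J = "enum_jump {}"
  have pos: "re_in ?J (\<lambda>x. T x \<in> W (E x))" if "computable T" "computable E" for T E
    using that by (rule re_in_W)
  have neg: "re_in ?J (\<lambda>x. T x \<notin> W (E x))" if "computable T" "computable E" for T E
    using that by (intro re_in_jump_not re_in_W)
  have bit: "diag_bit n t \<longleftrightarrow> (\<exists>m. n = 2 * m \<and> t \<notin> W m \<or> n = Suc (2 * m) \<and> t \<in> W m)"
    "\<not> diag_bit n t \<longleftrightarrow> (\<exists>m. n = 2 * m \<and> t \<in> W m \<or> n = Suc (2 * m) \<and> t \<notin> W m)" for n t
  proof -
    consider m where "n = 2 * m" | m where "n = Suc (2 * m)" by (metis evenE oddE Suc_eq_plus1)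
    then show "diag_bit n t \<longleftrightarrow> (\<exists>m. n = 2 * m \<and> t \<notin> W m \<or> n = Suc (2 * m) \<and> t \<in> W m)"
      "\<not> diag_bit n t \<longleftrightarrow> (\<exists>m. n = 2 * m \<and> t \<in> W m \<or> n = Suc (2 * m) \<and> t \<notin> W m)"
      by (cases; simp add: diag_bit_def Suc_double_not_eq_double double_not_eq_Suc_double)+
  qed
  have re_bit: "re_in ?J (\<lambda>x. diag_bit (E x) (T x))" "re_in ?J (\<lambda>x. \<not> diag_bit (E x) (T x))"
    if ET: "computable E" "computable T" for E T
    unfolding bit(2) unfolding bit(1)
    by (intro re_in_ex re_in_disj re_in_conj re_in_eq pos neg computable_intros
        computable_comp[OF ET(1)] computable_comp[OF ET(2)])+
  show ?thesis
    unfolding is_stage_def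
    by (intro re_in_ex re_in_all re_in_disj re_in_conj re_in_imp re_in_less re_bit
        re_in_set_decode re_in_decidable[OF decidable_iff] re_in_not[OF decidable_set_decode]
        computable_intros decidable_intros computable_comp[OF F] computable_comp[OF G])
qed

text \<open>
  Elements of \<open>D\<^sub>u\<close> are smaller than \<open>u\<close>, so the comparison of \<open>D\<^sub>u\<close> with
  \<open>diag\<close> is settled by the first \<open>u + 1\<close> bits of \<open>diag\<close>.
\<close>

lemma lower_cut_diag_le:
  "lower_cut diag \<le>\<^sub>e enum_jump {}" "- lower_cut diag \<le>\<^sub>e enum_jump {}"
proof -
  have cut: "u \<in> lower_cut diag \<longleftrightarrow> lex_le (set_decode u) (diag \<inter> {..<Suc u})" for u
  proof -
    have "j < Suc u" if "j < i" "i \<in> set_decode u" for i j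
      using that less_set_decode[of i u] by simp
    moreover have "i < Suc u" if "i \<in> set_decode u" for i
      using that less_set_decode[of i u] by simp
    ultimately show ?thesis
      unfolding lower_cut_def lex_le_def mem_Collect_eq Int_iff lessThan_iff by blast
  qed
  have "set_decode (set_encode (diag \<inter> {..<n})) = diag \<inter> {..<n}" for n
    by (intro set_encode_inverse) simp
  then have ex: "(\<exists>s. is_stage n s \<and> Q (set_decode s)) \<longleftrightarrow> Q (diag \<inter> {..<n})" for n Q
    unfolding is_stage_iff by metis
  have
    "u \<in> lower_cut diag \<longleftrightarrow> (\<exists>s. is_stage (Suc u) s \<and> lex_le (set_decode u) (set_decode s))"
    "u \<notin> lower_cut diag \<longleftrightarrow> (\<exists>s. is_stage (Suc u) s \<and> \<not> lex_le (set_decode u) (set_decode s))" for u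
    unfolding cut ex[of _ "lex_le (set_decode u)"] ex[of _ "\<lambda>T. \<not> lex_le (set_decode u) T"]
    by (rule refl)+
  moreover have
    "re_in (enum_jump {}) (\<lambda>u. \<exists>s. is_stage (Suc u) s \<and> lex_le (set_decode u) (set_decode s))"
    "re_in (enum_jump {}) (\<lambda>u. \<exists>s. is_stage (Suc u) s \<and> \<not> lex_le (set_decode u) (set_decode s))"
    unfolding lex_le_set_decode
    by (intro re_in_ex re_in_conj re_in_is_stage re_in_decidable decidable_intros computable_intros)+
  ultimately show "lower_cut diag \<le>\<^sub>e enum_jump {}" "- lower_cut diag \<le>\<^sub>e enum_jump {}"
    by (simp_all add: enum_le_iff)
qed

section \<open>The low degrees\<close>

theorem corollary5p15:
  "\<not> splitting_class {X. enum_jump X \<equiv>\<^sub>e enum_jump {}}"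
proof
  define Low where "Low = {X. enum_jump X \<equiv>\<^sub>e enum_jump {}}"
  assume "splitting_class {X. enum_jump X \<equiv>\<^sub>e enum_jump {}}"
  then have down: "\<And>A B. B \<in> Low \<Longrightarrow> A \<le>\<^sub>e B \<Longrightarrow> A \<in> Low"
    and split: "\<And>A \<B>. A \<in> Low \<Longrightarrow> finite \<B> \<Longrightarrow> \<B> \<subseteq> {B \<in> Low. \<not> B \<le>\<^sub>e A} \<Longrightarrow>
      \<exists>C\<in>Low. A <\<^sub>e C \<and> (\<forall>B\<in>\<B>. B \<oplus> C \<notin> Low)"
    unfolding splitting_class_def Low_def[symmetric] by blast+
  have Low_iff: "X \<in> Low \<longleftrightarrow> enum_jump X \<le>\<^sub>e enum_jump {}" for X
    by (simp add: Low_def enum_equiv_def enum_jump_empty_le)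
  let ?L = "lower_cut diag"
  have empty: "{} \<in> Low" by (simp add: Low_iff enum_jump_empty_le)
  have not_le: "\<not> ?L \<le>\<^sub>e {}" "\<not> - ?L \<le>\<^sub>e {}"
    using lower_cut_diag_not_ce by (simp_all add: enum_le_iff ce_iff)
  note pair = kalimullin_pair_lower_cut[of diag]
  \<comment> \<open>One half of the pair joins low sets to low sets as long as the other half is not below them.\<close>
  have join: "?L \<oplus> U \<in> Low" if "U \<in> Low" "\<not> - ?L \<le>\<^sub>e U" for U
    using kalimullin_pair_jump[OF pair that(2) lower_cut_diag_le] that(1) by (simp add: Low_iff)
  have join': "- ?L \<oplus> U \<in> Low" if "U \<in> Low" "\<not> ?L \<le>\<^sub>e U" for U
    using kalimullin_pair_jump[OF kalimullin_pair_sym[OF pair] that(2) lower_cut_diag_le(2,1)] that(1)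
    by (simp add: Low_iff)
  \<comment> \<open>The case \<open>U = {}\<close> shows that both halves are low.\<close>
  have "?L \<in> Low" "- ?L \<in> Low"
    using down[OF join[OF empty not_le(2)] le_join(1)]
      down[OF join'[OF empty not_le(1)] le_join(1)] by blast+
  then obtain C where C: "C \<in> Low" "?L \<oplus> C \<notin> Low" "- ?L \<oplus> C \<notin> Low"
    using split[OF empty, of "{?L, - ?L}"] not_le by auto
  have "- ?L \<le>\<^sub>e C" using join C by blast
  then have "- ?L \<oplus> C \<le>\<^sub>e C"
    using re_in_join[of C "- ?L" C] re_in_member[OF computable_id] by (simp add: enum_le_iff)
  then show False using down C by blast
qed

end
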